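(* Let $X$ be the standard Brownian motion, let $T>0$, and let $(\epsilon_n)_{n\in\mathbb{N}}$ be a decreasing sequence of positive real numbers satisfying $\sum_{i=1}^\infty\sqrt{\epsilon_i}<\infty$. For $\epsilon>0$, $t\ge0$, $x\in\mathbb{R}$ define $$J_\epsilon(t,x)=\frac1\epsilon\int_0^t\left(\mathbf 1_{\{x<X_{s+\epsilon}\}}-\mathbf 1_{\{x<X_s\}}\right)(X_{s+\epsilon}-X_s)\,ds,$$ $$I^{4,1}_\epsilon(t,x)=\frac1\epsilon\int_0^t(X_u-x)^-\mathbf 1_{\{X_{(u+\epsilon)\wedge t}>x\}}du,\qquad I^{4,2}_\epsilon(t,x)=\frac1\epsilon\int_0^t(X_u-x)^+\mathbf 1_{\{X_{(u+\epsilon)\wedge t}<x\}}du.$$ Then, for any $x\in\mathbb{R}$, almost surely, $$\lim_{n\to\infty}\ \sup_{t\in[0,T]}\left|J_{\epsilon_n}(t,x)-L_t^x(X)\right|=0,$$ $$\lim_{n\to\infty}\ \sup_{t\in[0,T]}\left|I^{4,i}_{\epsilon_n}(t,x)-\tfrac14L_t^x(X)\right|=0,\qquad i=1,2.$$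
   Context: Notation: $y^+=\max(y,0)$, $y^-=\max(-y,0)$, $a\wedge b=\min(a,b)$. $(L_t^x(X))_{x\in\mathbb{R},t\ge0}$ is the (continuous) local time family of Brownian motion, normalized by $\int_0^t g(X_s)\,ds=\int_{\mathbb{R}}g(x)L_t^x(X)\,dx$ for all non-negative Borel $g$. *)

theory Defs
  imports "HOL-Probability.Probability"
begin

(* Standard one-dimensional Brownian motion started at 0.  Time is indexed by real and only
   its values at nonnegative times are constrained. *)
locale standard_brownian_motion = prob_space M
  for M :: "'a measure" +
  fixes X :: "real \<Rightarrow> 'a \<Rightarrow> real"
  assumes random_variable_X: "\<And>t. 0 \<le> t \<Longrightarrow> X t \<in> borel_measurable M"
    and start_zero: "AE \<omega> in M. X 0 \<omega> = 0"
    and independent_increments: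
      "\<And>(n :: nat) (\<tau> :: nat \<Rightarrow> real). 0 \<le> \<tau> 0 \<Longrightarrow> (\<And>i. i < n \<Longrightarrow> \<tau> i \<le> \<tau> (Suc i)) \<Longrightarrow>
        indep_vars (\<lambda>_. borel) (\<lambda>i \<omega>. X (\<tau> (Suc i)) \<omega> - X (\<tau> i) \<omega>) {..<n}"
    and gaussian_increments:
      "\<And>s t. 0 \<le> s \<Longrightarrow> s < t \<Longrightarrow>
        distributed M lborel (\<lambda>\<omega>. X t \<omega> - X s \<omega>) (normal_density 0 (sqrt (t - s)))"
    and continuous_paths: "AE \<omega> in M. continuous_on {0..} (\<lambda>t. X t \<omega>)"

(* L t x \<omega> is the local time of X at level x and time t.  The occupation times formula holds
   simultaneously for all t and g off one null set; it is stated with nonnegative integrals, so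
   infinite values are covered, and nonnegativity of L is explicit because ennreal truncates
   negative reals to 0. *)
definition is_local_time :: "'a measure \<Rightarrow> (real \<Rightarrow> 'a \<Rightarrow> real) \<Rightarrow> (real \<Rightarrow> real \<Rightarrow> 'a \<Rightarrow> real) \<Rightarrow> bool"
  where "is_local_time M X L \<longleftrightarrow>
    (\<forall>t\<ge>0. \<forall>x. L t x \<in> borel_measurable M) \<and>
    (AE \<omega> in M. \<forall>t\<ge>0. \<forall>x. 0 \<le> L t x \<omega>) \<and>
    (AE \<omega> in M. continuous_on ({0..} \<times> UNIV) (\<lambda>(t, x). L t x \<omega>)) \<and>
    (AE \<omega> in M. \<forall>t\<ge>0. \<forall>g \<in> borel_measurable borel.
       (\<integral>\<^sup>+ s \<in> {0..t}. g (X s \<omega>) \<partial>lborel) = (\<integral>\<^sup>+ x. g x * ennreal (L t x \<omega>) \<partial>lborel))"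

definition pos_part :: "real \<Rightarrow> real" where "pos_part y = max y 0"

definition neg_part :: "real \<Rightarrow> real" where "neg_part y = max (- y) 0"

definition J :: "(real \<Rightarrow> 'a \<Rightarrow> real) \<Rightarrow> real \<Rightarrow> real \<Rightarrow> real \<Rightarrow> 'a \<Rightarrow> real" where
  "J X \<epsilon> t x \<omega> = 1 / \<epsilon> * (LBINT s:{0..t}.
     (of_bool (x < X (s + \<epsilon>) \<omega>) - of_bool (x < X s \<omega>)) * (X (s + \<epsilon>) \<omega> - X s \<omega>))"

definition I41 :: "(real \<Rightarrow> 'a \<Rightarrow> real) \<Rightarrow> real \<Rightarrow> real \<Rightarrow> real \<Rightarrow> 'a \<Rightarrow> real" where
  "I41 X \<epsilon> t x \<omega> = 1 / \<epsilon> * (LBINT u:{0..t}.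
     neg_part (X u \<omega> - x) * of_bool (X (min (u + \<epsilon>) t) \<omega> > x))"

definition I42 :: "(real \<Rightarrow> 'a \<Rightarrow> real) \<Rightarrow> real \<Rightarrow> real \<Rightarrow> real \<Rightarrow> 'a \<Rightarrow> real" where
  "I42 X \<epsilon> t x \<omega> = 1 / \<epsilon> * (LBINT u:{0..t}.
     pos_part (X u \<omega> - x) * of_bool (X (min (u + \<epsilon>) t) \<omega> < x))"

(* The supremum over [0,T] of the absolute difference.  It is taken in ennreal so that it is
   meaningful without a boundedness side condition. *)
definition sup_dist :: "real \<Rightarrow> (real \<Rightarrow> real) \<Rightarrow> (real \<Rightarrow> real) \<Rightarrow> ennreal" where
  "sup_dist T f g = (SUP t\<in>{0..T}. ennreal \<bar>f t - g t\<bar>)"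

end

theory Submission
  imports Defs
begin

text \<open>
All three functionals have the form \<open>(1/\<epsilon>) \<integral>\<^sub>0\<^sup>t h(X\<^sub>s - x, X\<^sub>s\<^sub>+\<^sub>\<epsilon> - X\<^sub>s) ds\<close>, up to the truncation of
\<open>s + \<epsilon>\<close> at \<open>t\<close> in two of them, for a nonnegative kernel \<open>h(y, z)\<close> that is homogeneous of degree 1,
bounded by \<open>\<bar>z\<bar>\<close>, and zero unless \<open>\<bar>y\<bar> \<le> \<bar>z\<bar>\<close> (locale \<^emph>\<open>crossing kernel\<close>). The proof is uniform in
such kernels and avoids stochastic integration.

Replace the integrand by its conditional expectation given the past up to time \<open>s\<close>. By homogeneity
this is \<open>sqrt \<epsilon> * \<psi>((X\<^sub>s - x) / sqrt \<epsilon>)\<close>, where \<open>\<psi>(y)\<close> is the expectation of \<open>h(y, Z)\<close> for a standard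
normal \<open>Z\<close>. The occupation times formula and the substitution \<open>y = x + sqrt \<epsilon> * u\<close> turn the time
average of the conditional expectation into \<open>\<integral> \<psi>(u) L\<^sub>t(x + sqrt \<epsilon> * u) du\<close>, which converges to
\<open>(\<integral> \<psi>) L\<^sub>t(x)\<close> by continuity of the local time in space. The integral of \<open>\<psi>\<close> is 1 for the first
functional and 1/4 for the other two.

The error of this replacement is the time average of deviations \<open>D\<^sub>s\<close> of a variable from its conditional
expectation. Deviations at times at least \<open>\<epsilon>\<close> apart are uncorrelated, so the double integral
for the second moment reduces to a band of width \<open>2\<epsilon>\<close> around the diagonal; and \<open>E D\<^sub>s\<^sup>2\<close> is at most of
order \<open>\<epsilon> * sqrt (\<epsilon> / s)\<close>, because the increment has variance \<open>\<epsilon>\<close> and the path must be within a distance of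
order \<open>sqrt \<epsilon>\<close> of the level. Altogether the second moment of the error is at most of order \<open>sqrt \<epsilon>\<close>. Summability of
\<open>sqrt \<epsilon>\<^sub>n\<close> therefore gives almost sure convergence to 0 at each fixed time.

Finally, the integrals increase with \<open>t\<close> and the local time is continuous in \<open>t\<close>, so convergence at all
rational times implies uniform convergence on compact time intervals. Truncating the window at \<open>t\<close> changes the
integral by at most the modulus of continuity of the path.

The lemmas that carry this are \<open>averaged_profile_tendsto\<close> (occupation times),
\<open>short_range_second_moment\<close> and \<open>crossing_second_moment\<close> (error), \<open>uniform_limit_mono_rational\<close>
and \<open>truncated_crossing_close\<close> (uniformity in time).
\<close>

section \<open>Uniform convergence of monotone functions\<close>

lemma sup_dist_tendsto_0I:
  assumes "uniform_limit {0..T} f l sequentially"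
  shows "(\<lambda>n. sup_dist T (f n) l) \<longlonglongrightarrow> 0"
proof (rule order_tendstoI)
  fix a :: ennreal assume "0 < a"
  then obtain e where e: "0 < e" "ennreal e < a"
    by (metis ennreal_0 ennreal_less_iff dense ennreal_cases less_top_ennreal order_less_imp_le order.strict_trans not_le)
  from uniform_limitD[OF assms \<open>0 < e\<close>]
  show "\<forall>\<^sub>F n in sequentially. sup_dist T (f n) l < a"
  proof eventually_elim
    case (elim n)
    have "sup_dist T (f n) l \<le> ennreal e"
      unfolding sup_dist_def
      using elim by (intro SUP_least ennreal_leI) (auto simp: dist_real_def less_imp_le)
    with e show ?case by (rule_tac le_less_trans)
  qed
qed simp

text \<open>A variant of Polya's theorem: between two neighbouring points of a fine rational grid, monotonicity
squeezes \<^term>\<open>f n t\<close> between two values that are already close to the limit, and uniform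
continuity of the limit makes those two values close to each other. Because only countably many
times are involved, almost sure convergence at fixed times suffices for almost sure uniform
convergence.\<close>

lemma uniform_limit_mono_rational:
  fixes f :: "nat \<Rightarrow> real \<Rightarrow> real"
  assumes mono: "\<And>n s t. 0 \<le> s \<Longrightarrow> s \<le> t \<Longrightarrow> f n s \<le> f n t"
    and lim: "\<And>q. q \<in> \<rat> \<Longrightarrow> 0 \<le> q \<Longrightarrow> (\<lambda>n. f n q) \<longlonglongrightarrow> l q"
    and cont: "continuous_on {0..} l"
  shows "uniform_limit {0..T} f l sequentially"
proof (rule uniform_limitI)
  fix e :: real assume "0 < e"
  have "uniformly_continuous_on {0..T+1} l"
    by (rule compact_uniformly_continuous) (auto intro: continuous_on_subset[OF cont])
  from this[unfolded uniformly_continuous_on_def, rule_format, OF half_gt_zero[OF \<open>0 < e\<close>]]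
  obtain d where d: "0 < d" "\<And>s t. s \<in> {0..T+1} \<Longrightarrow> t \<in> {0..T+1} \<Longrightarrow> dist t s < d \<Longrightarrow> dist (l t) (l s) < e/2"
    by blast
  obtain m :: nat where m: "0 < m" "inverse (real m) < min d 1"
    by (metis d(1) min_less_iff_conj reals_Archimedean zero_less_Suc zero_less_one)
  define G where "G = (\<lambda>k::nat. real k / real m) ` {..nat \<lceil>(T + 1) * real m\<rceil> + 1}"
  \<comment> \<open>\<^term>\<open>G\<close> reaches beyond \<^term>\<open>T\<close>, so that the grid point to the right of \<^term>\<open>t\<close> also belongs to it\<close>
  have "\<forall>\<^sub>F n in sequentially. \<forall>q\<in>G. dist (f n q) (l q) < e/2"
    using \<open>0 < e\<close> unfolding G_def
    by (intro eventually_ball_finite ballI tendstoD[OF lim]) auto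
  then show "\<forall>\<^sub>F n in sequentially. \<forall>t\<in>{0..T}. dist (f n t) (l t) < e"
  proof (eventually_elim, intro ballI)
    fix n t assume n: "\<forall>q\<in>G. dist (f n q) (l q) < e/2" and t: "t \<in> {0..T}"
    define k where "k = nat \<lfloor>t * real m\<rfloor>"
    define p where "p = real k / real m"
    define q where "q = real (Suc k) / real m"
    have k: "real k \<le> t * real m" "t * real m < real (Suc k)"
      using mult_nonneg_nonneg[of t "real m"] t unfolding k_def by auto linarith
    have pq: "0 \<le> p" "p \<le> t" "t < q" "q = p + inverse (real m)"
      using k m by (auto simp: p_def q_def field_simps)
    have "real k \<le> (T + 1) * real m"
      using k(1) t mult_right_mono[of t "T+1" "real m"] by (simp del: mult_le_cancel_right)
    then have "k \<le> nat \<lceil>(T + 1) * real m\<rceil>" by linarith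
    then have G: "p \<in> G" "q \<in> G"
      unfolding p_def q_def G_def by (auto intro!: imageI simp del: of_nat_Suc)
    have "dist (l p) (l t) < e/2" "dist (l q) (l t) < e/2"
      using d(2)[of t p] d(2)[of t q] pq t m by (auto simp: dist_real_def)
    moreover have "dist (f n p) (l p) < e/2" "dist (f n q) (l q) < e/2"
      using n G by auto
    moreover have "f n p \<le> f n t" "f n t \<le> f n q"
      using pq by (auto intro!: mono)
    ultimately show "dist (f n t) (l t) < e"
      unfolding dist_real_def by linarith
  qed
qed

lemma tendsto_0_if_summable_sqrt:
  fixes \<epsilon> :: "nat \<Rightarrow> real"
  assumes "summable (\<lambda>n. sqrt (\<epsilon> n))" "\<And>n. 0 < \<epsilon> n"
  shows "\<epsilon> \<longlonglongrightarrow> 0"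
proof -
  have "(\<lambda>n. (sqrt (\<epsilon> n))\<^sup>2) \<longlonglongrightarrow> 0\<^sup>2"
    by (intro tendsto_power summable_LIMSEQ_zero assms(1))
  then show ?thesis using assms(2) by (simp add: less_imp_le)
qed

section \<open>Moments of the standard normal law\<close>

definition std_normal :: "real measure" where
  "std_normal = density lborel (\<lambda>z. ennreal (std_normal_density z))"

lemma sets_std_normal [measurable_cong, simp]: "sets std_normal = sets borel"
  by (simp add: std_normal_def)

lemma space_std_normal [simp]: "space std_normal = UNIV"
  by (simp add: std_normal_def)

lemma prob_space_std_normal: "prob_space std_normal"
  unfolding std_normal_def by (rule prob_space_normal_density) simp

interpretation std_normal: prob_space std_normal
  by (rule prob_space_std_normal)

lemma integrable_std_normal_abs_power: "integrable std_normal (\<lambda>z. \<bar>z\<bar> ^ k)"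
  unfolding std_normal_def
  using integrable_normal_moment_abs[of 1 0 k]
  by (subst integrable_density) auto

lemma integrable_std_normal_power: "integrable std_normal (\<lambda>z. z ^ k)"
  unfolding std_normal_def
  using integrable_normal_moment[of 1 0 k]
  by (subst integrable_density) auto

definition third_moment :: real where "third_moment = (\<integral>z. \<bar>z\<bar> ^ 3 \<partial>std_normal)"

lemma third_moment_nonneg: "0 \<le> third_moment"
  by (simp add: third_moment_def)

lemma nn_integral_std_normal_abs_cubed:
  "(\<integral>\<^sup>+z. ennreal (\<bar>z\<bar> ^ 3) \<partial>std_normal) = ennreal third_moment"
  unfolding third_moment_def
  by (rule nn_integral_eq_integral[OF integrable_std_normal_abs_power]) auto

lemma nn_integral_std_normal_square: "(\<integral>\<^sup>+z. ennreal (z\<^sup>2) \<partial>std_normal) = 1"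
proof -
  have "(\<integral>z. z\<^sup>2 \<partial>std_normal) = 1"
    unfolding std_normal_def
    using integral_std_normal_moment_even[of 1] by (subst integral_density) auto
  then show ?thesis
    by (subst nn_integral_eq_integral[OF integrable_std_normal_power]) auto
qed

lemma nn_integral_std_normal_uminus:
  assumes [measurable]: "f \<in> borel_measurable borel"
  shows "(\<integral>\<^sup>+z. f (- z) \<partial>std_normal) = (\<integral>\<^sup>+z. f z \<partial>std_normal)"
proof -
  have "(\<integral>\<^sup>+z. f z \<partial>std_normal) = (\<integral>\<^sup>+z. ennreal (std_normal_density z) * f z \<partial>lborel)"
    unfolding std_normal_def by (simp add: nn_integral_density)
  also have "\<dots> = (\<integral>\<^sup>+z. ennreal (std_normal_density z) * f (- z) \<partial>lborel)"
    by (subst nn_integral_real_affine[where c="-1" and t=0]) (auto simp: std_normal_density_def)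
  also have "\<dots> = (\<integral>\<^sup>+z. f (- z) \<partial>std_normal)"
    unfolding std_normal_def by (simp add: nn_integral_density)
  finally show ?thesis by simp
qed

text \<open>By symmetry, each half line carries half of the second moment.\<close>

lemma nn_integral_std_normal_half_square:
  "(\<integral>\<^sup>+z. ennreal (z\<^sup>2 / 2 * of_bool (0 < z)) \<partial>std_normal) = ennreal (1/4)"
  "(\<integral>\<^sup>+z. ennreal (z\<^sup>2 / 2 * of_bool (z < 0)) \<partial>std_normal) = ennreal (1/4)"
proof -
  let ?p = "\<integral>\<^sup>+z. ennreal (z\<^sup>2 / 2 * of_bool (0 < z)) \<partial>std_normal"
  let ?n = "\<integral>\<^sup>+z. ennreal (z\<^sup>2 / 2 * of_bool (z < 0)) \<partial>std_normal"
  have eq: "?n = ?p"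
    using nn_integral_std_normal_uminus[of "\<lambda>z. ennreal (z\<^sup>2 / 2 * of_bool (0 < z))"] by simp
  have "2 * (?p + ?n) = 2 * (\<integral>\<^sup>+z. ennreal (z\<^sup>2 / 2) \<partial>std_normal)"
    by (subst nn_integral_add[symmetric])
       (auto intro!: arg_cong[where f="\<lambda>x. 2 * x"] nn_integral_cong simp flip: ennreal_plus)
  also have "\<dots> = 1"
    by (subst nn_integral_cmult[symmetric])
       (auto simp flip: nn_integral_std_normal_square ennreal_numeral ennreal_mult)
  finally have "2 * (?p + ?p) = 1"
    using eq by simp
  then show "?p = ennreal (1/4)"
    by (cases ?p) (auto simp flip: ennreal_plus ennreal_numeral ennreal_mult simp: ennreal_mult_eq_top_iff)
  with eq show "?n = ennreal (1/4)" by simp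
qed

section \<open>Crossing kernels\<close>

text \<open>A kernel is evaluated at the signed distance \<^term>\<open>y\<close> of the path to the level and at the next
increment \<^term>\<open>z\<close>. The bound and the support condition say that only increments that are long
enough to reach the level count, and that they count at most by their length; homogeneity is what
makes Brownian scaling applicable.\<close>

locale crossing_kernel =
  fixes h :: "real \<Rightarrow> real \<Rightarrow> real"
  assumes measurable_kernel [measurable]: "case_prod h \<in> borel_measurable (borel \<Otimes>\<^sub>M borel)"
    and kernel_nonneg: "0 \<le> h y z"
    and kernel_le: "h y z \<le> \<bar>z\<bar>"
    and kernel_support: "\<bar>z\<bar> < \<bar>y\<bar> \<Longrightarrow> h y z = 0"
    and kernel_homogeneous: "0 < c \<Longrightarrow> h (c * y) (c * z) = c * h y z"
begin

text \<open>The expected kernel value given the distance to the level, for a standard normal increment. Its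
total \<open>mass\<close> turns out to be the factor in front of the local time.\<close>

definition profile :: "real \<Rightarrow> real" where "profile y = (\<integral>z. h y z \<partial>std_normal)"

definition mass :: real where "mass = (\<integral>y. profile y \<partial>lborel)"

lemma measurable_profile [measurable]: "profile \<in> borel_measurable borel"
  unfolding profile_def by measurable

lemma kernel_power_integrable: "integrable std_normal (\<lambda>z. h y (c * z) ^ k)"
proof (rule Bochner_Integration.integrable_bound)
  show "integrable std_normal (\<lambda>z. \<bar>c\<bar> ^ k * \<bar>z\<bar> ^ k)"
    by (intro integrable_mult_right integrable_std_normal_abs_power)
  have "h y (c * z) ^ k \<le> \<bar>c\<bar> ^ k * \<bar>z\<bar> ^ k" for z
    using power_mono[OF kernel_le kernel_nonneg, of y "c * z" k]
    by (simp add: abs_mult power_mult_distrib)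
  then show "AE z in std_normal. norm (h y (c * z) ^ k) \<le> norm (\<bar>c\<bar> ^ k * \<bar>z\<bar> ^ k)"
    by (auto simp: kernel_nonneg)
qed measurable

lemmas kernel_integrable = kernel_power_integrable[where k=1, simplified]

lemma profile_nonneg: "0 \<le> profile y"
  by (simp add: profile_def kernel_nonneg)

text \<open>Homogeneity reduces an increment of variance \<open>c\<^sup>2\<close> to the standard one; divided by
\<open>c\<^sup>2\<close>, the right-hand side is an approximate identity (up to \<open>mass\<close>) as \<open>c \<longlongrightarrow> 0\<close>.\<close>

lemma profile_scaled: "0 < c \<Longrightarrow> (\<integral>z. h y (c * z) \<partial>std_normal) = c * profile (y / c)"
  using kernel_homogeneous[of c "y / c"] by (simp add: profile_def)

lemma profile_le: "profile y \<le> (\<integral>z. \<bar>z\<bar> \<partial>std_normal)"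
  unfolding profile_def
  using kernel_integrable[of y 1] integrable_std_normal_abs_power[of 1]
  by (intro integral_mono) (auto intro: kernel_le)

lemma nn_integral_profile:
  "(\<integral>\<^sup>+y. ennreal (profile y) \<partial>lborel) = (\<integral>\<^sup>+z. (\<integral>\<^sup>+y. ennreal (h y z) \<partial>lborel) \<partial>std_normal)"
proof -
  interpret pair_sigma_finite lborel std_normal ..
  have "(\<integral>\<^sup>+y. ennreal (profile y) \<partial>lborel)
      = (\<integral>\<^sup>+y. (\<integral>\<^sup>+z. ennreal (h y z) \<partial>std_normal) \<partial>lborel)"
    unfolding profile_def
    using kernel_integrable[of _ 1]
    by (intro nn_integral_cong nn_integral_eq_integral[symmetric]) (auto simp: kernel_nonneg)
  also have "\<dots> = (\<integral>\<^sup>+z. (\<integral>\<^sup>+y. ennreal (h y z) \<partial>lborel) \<partial>std_normal)"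
    by (subst Fubini') auto
  finally show ?thesis .
qed

text \<open>For a fixed increment \<^term>\<open>z\<close>, the kernel is at most \<open>\<bar>z\<bar>\<close> on an interval of length
\<open>2\<bar>z\<bar>\<close>, and the normal law has a second moment.\<close>

lemma integrable_profile: "integrable lborel profile"
proof (rule integrableI_nonneg)
  have "(\<integral>\<^sup>+y. ennreal (profile y) \<partial>lborel)
      \<le> (\<integral>\<^sup>+z. (\<integral>\<^sup>+y. ennreal \<bar>z\<bar> * indicator {-\<bar>z\<bar>..\<bar>z\<bar>} y \<partial>lborel) \<partial>std_normal)"
    unfolding nn_integral_profile
    using kernel_support kernel_le
    by (intro nn_integral_mono) (force simp: indicator_def intro!: ennreal_leI)
  also have "\<dots> = (\<integral>\<^sup>+z. 2 * ennreal (z\<^sup>2) \<partial>std_normal)"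
    by (intro nn_integral_cong)
       (auto simp: nn_integral_cmult power2_eq_square simp flip: ennreal_mult ennreal_numeral)
  also have "\<dots> < \<infinity>"
    by (simp add: nn_integral_cmult nn_integral_std_normal_square)
  finally show "(\<integral>\<^sup>+y. ennreal (profile y) \<partial>lborel) < \<infinity>" .
qed (auto simp: profile_nonneg)

lemma mass_eqI:
  assumes "(\<integral>\<^sup>+z. (\<integral>\<^sup>+y. ennreal (h y z) \<partial>lborel) \<partial>std_normal) = ennreal m" "0 \<le> m"
  shows "mass = m"
proof -
  have "ennreal mass = ennreal m"
    unfolding mass_def assms(1)[symmetric] nn_integral_profile[symmetric]
    by (rule nn_integral_eq_integral[OF integrable_profile, symmetric]) (simp add: profile_nonneg)
  moreover have "0 \<le> mass" by (simp add: mass_def profile_nonneg)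
  ultimately show ?thesis using assms(2) by (simp add: ennreal_inj)
qed

end

text \<open>The kernels of the three functionals. The first one is the length of the increment if the path goes
from one side of the level to the other; the other two are restricted to one direction and keep only
the part of the increment before the level.\<close>

definition sign_change :: "real \<Rightarrow> real \<Rightarrow> real" where
  "sign_change y z = (of_bool (0 < y + z) - of_bool (0 < y)) * z"

definition up_cross :: "real \<Rightarrow> real \<Rightarrow> real" where
  "up_cross y z = neg_part y * of_bool (0 < y + z)"

definition down_cross :: "real \<Rightarrow> real \<Rightarrow> real" where
  "down_cross y z = pos_part y * of_bool (y + z < 0)"

lemma homogeneous_sign: "0 < c \<Longrightarrow> (0 < c * y + c * z) = (0 < y + (z::real))"
   "0 < c \<Longrightarrow> (c * y + c * z < 0) = (y + (z::real) < 0)"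
  by (simp_all flip: distrib_left add: zero_less_mult_iff mult_less_0_iff)

interpretation sign_change: crossing_kernel sign_change
proof
  show "case_prod sign_change \<in> borel_measurable (borel \<Otimes>\<^sub>M borel)"
    unfolding sign_change_def by measurable
  fix y z c :: real
  show "0 \<le> sign_change y z" "sign_change y z \<le> \<bar>z\<bar>"
    by (cases "0 < y + z"; cases "0 < y"; simp add: sign_change_def)+
  show "sign_change y z = 0" if "\<bar>z\<bar> < \<bar>y\<bar>"
    using that by (cases "0 < y + z"; cases "0 < y"; simp add: sign_change_def)
  show "sign_change (c * y) (c * z) = c * sign_change y z" if "0 < c"
    using that by (simp add: sign_change_def homogeneous_sign zero_less_mult_iff)
qed

interpretation up_cross: crossing_kernel up_cross
proof
  show "case_prod up_cross \<in> borel_measurable (borel \<Otimes>\<^sub>M borel)"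
    unfolding up_cross_def neg_part_def by measurable
  fix y z c :: real
  show "0 \<le> up_cross y z" "up_cross y z \<le> \<bar>z\<bar>"
    by (cases "0 < y + z"; simp add: up_cross_def neg_part_def)+
  show "up_cross y z = 0" if "\<bar>z\<bar> < \<bar>y\<bar>"
    using that by (cases "0 < y + z"; simp add: up_cross_def neg_part_def)
  show "up_cross (c * y) (c * z) = c * up_cross y z" if "0 < c"
    using that max_mult_distrib_left[of c "- y" 0]
    by (simp add: up_cross_def neg_part_def homogeneous_sign)
qed

interpretation down_cross: crossing_kernel down_cross
proof
  show "case_prod down_cross \<in> borel_measurable (borel \<Otimes>\<^sub>M borel)"
    unfolding down_cross_def pos_part_def by measurable
  fix y z c :: real
  show "0 \<le> down_cross y z" "down_cross y z \<le> \<bar>z\<bar>"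
    by (cases "y + z < 0"; simp add: down_cross_def pos_part_def)+
  show "down_cross y z = 0" if "\<bar>z\<bar> < \<bar>y\<bar>"
    using that by (cases "y + z < 0"; simp add: down_cross_def pos_part_def)
  show "down_cross (c * y) (c * z) = c * down_cross y z" if "0 < c"
    using that max_mult_distrib_left[of c y 0]
    by (simp add: down_cross_def pos_part_def homogeneous_sign)
qed

text \<open>By Tonelli, the distance can be integrated first: an increment \<^term>\<open>z\<close> starting from a
uniformly distributed position contributes \<open>z\<^sup>2\<close>, and the second moment is 1.\<close>

lemma mass_sign_change: "sign_change.mass = 1"
proof (rule sign_change.mass_eqI)
  have "(\<integral>\<^sup>+y. ennreal (sign_change y z) \<partial>lborel) = ennreal (z\<^sup>2)" for z
  proof -
    have "(\<integral>\<^sup>+y. ennreal (sign_change y z) \<partial>lborel)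
        = (\<integral>\<^sup>+y. ennreal \<bar>z\<bar> * indicator (if 0 < z then {-z<..0} else {0<..-z}) y \<partial>lborel)"
      by (intro nn_integral_cong) (auto simp: sign_change_def indicator_def)
    then show ?thesis
      by (auto simp: nn_integral_cmult power2_eq_square simp flip: ennreal_mult split: if_splits)
  qed
  then show "(\<integral>\<^sup>+z. (\<integral>\<^sup>+y. ennreal (sign_change y z) \<partial>lborel) \<partial>std_normal) = ennreal 1"
    by (simp add: nn_integral_std_normal_square)
qed simp

text \<open>Here an increment in the right direction contributes the area \<open>z\<^sup>2 / 2\<close> of a triangle, and the
wrong direction contributes nothing; this gives half of half of the second moment.\<close>

lemma mass_down_cross: "down_cross.mass = 1/4"
proof (rule down_cross.mass_eqI)
  have "(\<integral>\<^sup>+y. ennreal (down_cross y z) \<partial>lborel) = ennreal (z\<^sup>2 / 2 * of_bool (z < 0))" for z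
  proof (cases "z < 0")
    case True
    have "(\<integral>\<^sup>+y. ennreal (down_cross y z) \<partial>lborel) = (\<integral>\<^sup>+y. ennreal y * indicator {0..-z} y \<partial>lborel)"
      by (intro nn_integral_cong_AE, use AE_lborel_singleton[of "-z"] in eventually_elim)
         (auto simp: down_cross_def pos_part_def indicator_def)
    also have "\<dots> = ennreal ((-z)\<^sup>2 / 2 - 0\<^sup>2 / 2)"
      using True
      by (intro nn_integral_FTC_Icc[where F="\<lambda>y. y\<^sup>2 / 2"])
         (auto intro!: derivative_eq_intros)
    finally show ?thesis using True by simp
  next
    case False
    then have "ennreal (down_cross y z) = 0" for y
      by (auto simp: down_cross_def pos_part_def)
    with False show ?thesis by simp
  qed
  then show "(\<integral>\<^sup>+z. (\<integral>\<^sup>+y. ennreal (down_cross y z) \<partial>lborel) \<partial>std_normal) = ennreal (1/4)"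
    using nn_integral_std_normal_half_square by simp
qed simp

lemma mass_up_cross: "up_cross.mass = 1/4"
proof (rule up_cross.mass_eqI)
  have "(\<integral>\<^sup>+y. ennreal (up_cross y z) \<partial>lborel) = ennreal (z\<^sup>2 / 2 * of_bool (0 < z))" for z
  proof (cases "0 < z")
    case True
    have "(\<integral>\<^sup>+y. ennreal (up_cross y z) \<partial>lborel) = (\<integral>\<^sup>+y. ennreal (- y) * indicator {-z..0} y \<partial>lborel)"
      by (intro nn_integral_cong_AE, use AE_lborel_singleton[of "-z"] in eventually_elim)
         (auto simp: up_cross_def neg_part_def indicator_def)
    also have "\<dots> = ennreal (- 0\<^sup>2 / 2 - (- (-z)\<^sup>2 / 2))"
      using True
      by (intro nn_integral_FTC_Icc[where F="\<lambda>y. - y\<^sup>2 / 2"])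
         (auto intro!: derivative_eq_intros)
    finally show ?thesis using True by simp
  next
    case False
    then have "ennreal (up_cross y z) = 0" for y
      by (auto simp: up_cross_def neg_part_def)
    with False show ?thesis by simp
  qed
  then show "(\<integral>\<^sup>+z. (\<integral>\<^sup>+y. ennreal (up_cross y z) \<partial>lborel) \<partial>std_normal) = ennreal (1/4)"
    using nn_integral_std_normal_half_square by simp
qed simp

section \<open>Time integrals of short-range correlated variables\<close>

text \<open>The second moment of a time integral is the double integral of the correlations
\<open>E (D r * D s)\<close>. If these vanish off a band of width \<open>c\<close>, then bounding them on the band by
\<open>(v r + v s) / 2\<close>, which dominates them since \<open>2ab \<le> a\<^sup>2 + b\<^sup>2\<close>, leaves \<open>c\<close> times a
single integral.\<close>

lemma short_range_second_moment:
  fixes D :: "'t \<Rightarrow> 'a \<Rightarrow> real"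
  assumes "finite_measure \<nu>" "finite_measure M"
    and D [measurable]: "case_prod D \<in> borel_measurable (\<nu> \<Otimes>\<^sub>M M)"
    and v: "integrable \<nu> v"
    and D2: "\<And>s. s \<in> space \<nu> \<Longrightarrow> integrable M (\<lambda>\<omega>. (D s \<omega>)\<^sup>2)"
      "\<And>s. s \<in> space \<nu> \<Longrightarrow> (\<integral>\<omega>. (D s \<omega>)\<^sup>2 \<partial>M) \<le> v s"
    and R [measurable]: "R \<in> sets (\<nu> \<Otimes>\<^sub>M \<nu>)"
    and width: "\<And>r. r \<in> space \<nu> \<Longrightarrow> measure \<nu> {s \<in> space \<nu>. (r, s) \<in> R} \<le> c"
      "\<And>s. s \<in> space \<nu> \<Longrightarrow> measure \<nu> {r \<in> space \<nu>. (r, s) \<in> R} \<le> c"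
    and orth: "\<And>r s. r \<in> space \<nu> \<Longrightarrow> s \<in> space \<nu> \<Longrightarrow> (r, s) \<notin> R \<Longrightarrow> (\<integral>\<omega>. D r \<omega> * D s \<omega> \<partial>M) = 0"
  shows "integrable M (\<lambda>\<omega>. (\<integral>s. D s \<omega> \<partial>\<nu>)\<^sup>2)"
    and "(\<integral>\<omega>. (\<integral>s. D s \<omega> \<partial>\<nu>)\<^sup>2 \<partial>M) \<le> c * (\<integral>s. v s \<partial>\<nu>)"
proof -
  interpret T: finite_measure \<nu> by fact
  interpret M: finite_measure M by fact
  interpret TT: pair_sigma_finite \<nu> \<nu> ..
  interpret TTM: pair_sigma_finite "\<nu> \<Otimes>\<^sub>M \<nu>" M ..
  have [measurable]: "v \<in> borel_measurable \<nu>" using v by auto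
  have v_nonneg: "0 \<le> v s" if "s \<in> space \<nu>" for s
    using D2(2)[OF that] by (rule order_trans[rotated]) simp
  define f where "f = (\<lambda>p \<omega>. D (fst p) \<omega> * D (snd p) \<omega>)"
  have f_meas [measurable]: "case_prod f \<in> borel_measurable ((\<nu> \<Otimes>\<^sub>M \<nu>) \<Otimes>\<^sub>M M)"
    unfolding f_def by measurable
  have am_gm: "\<bar>a * b\<bar> \<le> (a\<^sup>2 + b\<^sup>2) / 2" for a b :: real
    using sum_squares_bound[of "\<bar>a\<bar>" "\<bar>b\<bar>"] by (simp add: abs_mult)
  have f_int: "integrable M (\<lambda>\<omega>. D r \<omega> * D s \<omega>)"
    and f_le: "(\<integral>\<omega>. \<bar>D r \<omega> * D s \<omega>\<bar> \<partial>M) \<le> (v r + v s) / 2"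
    if r: "r \<in> space \<nu>" and s: "s \<in> space \<nu>" for r s
  proof -
    have int2: "integrable M (\<lambda>\<omega>. ((D r \<omega>)\<^sup>2 + (D s \<omega>)\<^sup>2) / 2)"
      using D2(1)[OF r] D2(1)[OF s] by auto
    show int: "integrable M (\<lambda>\<omega>. D r \<omega> * D s \<omega>)"
      by (rule Bochner_Integration.integrable_bound[OF int2])
         (use am_gm r s in \<open>auto simp: abs_mult\<close>)
    have "(\<integral>\<omega>. \<bar>D r \<omega> * D s \<omega>\<bar> \<partial>M) \<le> (\<integral>\<omega>. ((D r \<omega>)\<^sup>2 + (D s \<omega>)\<^sup>2) / 2 \<partial>M)"
      using int int2 am_gm by (intro integral_mono) auto
    also have "\<dots> \<le> (v r + v s) / 2"
      using D2[OF r] D2[OF s] by simp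
    finally show "(\<integral>\<omega>. \<bar>D r \<omega> * D s \<omega>\<bar> \<partial>M) \<le> (v r + v s) / 2" .
  qed
  have v1: "integrable (\<nu> \<Otimes>\<^sub>M \<nu>) (\<lambda>p. v (fst p))"
  proof (rule TT.Fubini_integrable)
    show "AE x in \<nu>. integrable \<nu> (\<lambda>y. v (fst (x, y)))" by simp
  qed (use v in \<open>auto intro!: integrable_mult_right\<close>)
  have v2: "integrable (\<nu> \<Otimes>\<^sub>M \<nu>) (\<lambda>p. v (snd p))"
    using TT.integrable_product_swap[OF v1] by (simp add: case_prod_beta' )
  have fi: "integrable ((\<nu> \<Otimes>\<^sub>M \<nu>) \<Otimes>\<^sub>M M) (case_prod f)"
  proof (rule TTM.Fubini_integrable)
    show "integrable (\<nu> \<Otimes>\<^sub>M \<nu>) (\<lambda>p. \<integral>\<omega>. norm (case_prod f (p, \<omega>)) \<partial>M)"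
    proof (rule Bochner_Integration.integrable_bound)
      show "integrable (\<nu> \<Otimes>\<^sub>M \<nu>) (\<lambda>p. (v (fst p) + v (snd p)) / 2)"
        using v1 v2 by auto
      show "AE p in \<nu> \<Otimes>\<^sub>M \<nu>. norm (\<integral>\<omega>. norm (case_prod f (p, \<omega>)) \<partial>M)
          \<le> norm ((v (fst p) + v (snd p)) / 2)"
        using f_le v_nonneg by (intro AE_I2) (auto simp: f_def space_pair_measure)
    qed measurable
    show "AE p in \<nu> \<Otimes>\<^sub>M \<nu>. integrable M (\<lambda>\<omega>. case_prod f (p, \<omega>))"
      using f_int by (intro AE_I2) (auto simp: f_def space_pair_measure)
  qed measurable
  \<comment> \<open>Fubini inside the square holds only for those outcomes where the double integral converges\<close>
  have sq: "AE \<omega> in M. (\<integral>p. f p \<omega> \<partial>(\<nu> \<Otimes>\<^sub>M \<nu>)) = (\<integral>s. D s \<omega> \<partial>\<nu>)\<^sup>2"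
    using TTM.AE_integrable_snd[OF fi]
  proof eventually_elim
    case (elim \<omega>)
    have "(\<integral>p. f p \<omega> \<partial>(\<nu> \<Otimes>\<^sub>M \<nu>)) = (\<integral>r. (\<integral>s. f (r, s) \<omega> \<partial>\<nu>) \<partial>\<nu>)"
      by (rule TT.integral_fst'[OF elim, symmetric])
    then show ?case by (simp add: f_def power2_eq_square)
  qed
  have "integrable M (\<lambda>\<omega>. \<integral>p. f p \<omega> \<partial>(\<nu> \<Otimes>\<^sub>M \<nu>))"
    by (rule TTM.integrable_snd[OF fi])
  then show "integrable M (\<lambda>\<omega>. (\<integral>s. D s \<omega> \<partial>\<nu>)\<^sup>2)"
    using sq by (subst (asm) integrable_cong_AE) auto
  have i1: "integrable (\<nu> \<Otimes>\<^sub>M \<nu>) (\<lambda>p. v (fst p) * indicator R p)"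
    and i2: "integrable (\<nu> \<Otimes>\<^sub>M \<nu>) (\<lambda>p. v (snd p) * indicator R p)"
    using v1 v2 by (auto intro: integrable_real_mult_indicator)
  have "(\<integral>\<omega>. (\<integral>s. D s \<omega> \<partial>\<nu>)\<^sup>2 \<partial>M) = (\<integral>\<omega>. (\<integral>p. f p \<omega> \<partial>(\<nu> \<Otimes>\<^sub>M \<nu>)) \<partial>M)"
    using sq by (intro integral_cong_AE) auto
  also have "\<dots> = (\<integral>p. (\<integral>\<omega>. f p \<omega> \<partial>M) \<partial>(\<nu> \<Otimes>\<^sub>M \<nu>))"
    using TTM.integral_snd[OF fi] TTM.integral_fst'[OF fi] by simp
  also have "\<dots> \<le> (\<integral>p. (v (fst p) * indicator R p + v (snd p) * indicator R p) / 2 \<partial>(\<nu> \<Otimes>\<^sub>M \<nu>))"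
  proof (rule integral_mono)
    show "integrable (\<nu> \<Otimes>\<^sub>M \<nu>) (\<lambda>p. \<integral>\<omega>. f p \<omega> \<partial>M)"
      using TTM.integrable_fst'[OF fi] by simp
    fix p assume p: "p \<in> space (\<nu> \<Otimes>\<^sub>M \<nu>)"
    obtain r s where rs: "p = (r, s)" "r \<in> space \<nu>" "s \<in> space \<nu>"
      using p by (auto simp: space_pair_measure)
    show "(\<integral>\<omega>. f p \<omega> \<partial>M) \<le> (v (fst p) * indicator R p + v (snd p) * indicator R p) / 2"
    proof (cases "p \<in> R")
      case True
      have "(\<integral>\<omega>. f p \<omega> \<partial>M) \<le> (\<integral>\<omega>. \<bar>D r \<omega> * D s \<omega>\<bar> \<partial>M)"
        unfolding rs f_def using f_int[OF rs(2,3)] by (simp, intro integral_mono) auto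
      with f_le[OF rs(2,3)] True show ?thesis by (simp add: rs)
    next
      case False
      with orth rs show ?thesis by (simp add: f_def)
    qed
  qed (use i1 i2 in auto)
  also have "\<dots> = ((\<integral>p. v (fst p) * indicator R p \<partial>(\<nu> \<Otimes>\<^sub>M \<nu>))
      + (\<integral>p. v (snd p) * indicator R p \<partial>(\<nu> \<Otimes>\<^sub>M \<nu>))) / 2"
    using i1 i2 by simp
  also have "(\<integral>p. v (fst p) * indicator R p \<partial>(\<nu> \<Otimes>\<^sub>M \<nu>)) \<le> c * (\<integral>s. v s \<partial>\<nu>)"
  proof -
    have "(\<integral>p. v (fst p) * indicator R p \<partial>(\<nu> \<Otimes>\<^sub>M \<nu>))
        = (\<integral>r. v r * measure \<nu> {s \<in> space \<nu>. (r, s) \<in> R} \<partial>\<nu>)"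
    proof (subst TT.integral_fst'[OF i1, symmetric], intro Bochner_Integration.integral_cong refl)
      fix r assume "r \<in> space \<nu>"
      then have "{s \<in> space \<nu>. (r, s) \<in> R} \<in> sets \<nu>" by measurable
      moreover have "(\<integral>s. indicat_real R (r, s) \<partial>\<nu>) = (\<integral>s. indicator {s \<in> space \<nu>. (r, s) \<in> R} s \<partial>\<nu>)"
        by (intro Bochner_Integration.integral_cong) (auto simp: indicator_def)
      ultimately show "(\<integral>s. v (fst (r, s)) * indicator R (r, s) \<partial>\<nu>)
          = v r * measure \<nu> {s \<in> space \<nu>. (r, s) \<in> R}"
        by (simp add: Int_absorb2 subset_eq)
    qed
    also have "\<dots> \<le> (\<integral>r. v r * c \<partial>\<nu>)"
      using width(1) v v_nonneg
      by (intro integral_mono' integrable_mult_left mult_left_mono mult_nonneg_nonneg)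
         (auto intro: order_trans[OF measure_nonneg])
    finally show ?thesis by (simp add: mult.commute)
  qed
  also have "(\<integral>p. v (snd p) * indicator R p \<partial>(\<nu> \<Otimes>\<^sub>M \<nu>)) \<le> c * (\<integral>s. v s \<partial>\<nu>)"
  proof -
    have "(\<integral>p. v (snd p) * indicator R p \<partial>(\<nu> \<Otimes>\<^sub>M \<nu>))
        = (\<integral>s. v s * measure \<nu> {r \<in> space \<nu>. (r, s) \<in> R} \<partial>\<nu>)"
    proof -
      have "(\<integral>p. v (snd p) * indicator R p \<partial>(\<nu> \<Otimes>\<^sub>M \<nu>))
         = (\<integral>s. (\<integral>r. v (snd (r, s)) * indicator R (r, s) \<partial>\<nu>) \<partial>\<nu>)"
        using i2 by (subst TT.integral_snd) (auto simp: case_prod_beta')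
      also have "\<dots> = (\<integral>s. v s * measure \<nu> {r \<in> space \<nu>. (r, s) \<in> R} \<partial>\<nu>)"
      proof (intro Bochner_Integration.integral_cong refl)
        fix s assume "s \<in> space \<nu>"
        then have "{r \<in> space \<nu>. (r, s) \<in> R} \<in> sets \<nu>" by measurable
        moreover have "(\<integral>r. indicat_real R (r, s) \<partial>\<nu>) = (\<integral>r. indicator {r \<in> space \<nu>. (r, s) \<in> R} r \<partial>\<nu>)"
          by (intro Bochner_Integration.integral_cong) (auto simp: indicator_def)
        ultimately show "(\<integral>r. v (snd (r, s)) * indicator R (r, s) \<partial>\<nu>)
            = v s * measure \<nu> {r \<in> space \<nu>. (r, s) \<in> R}"
          by (simp add: Int_absorb2 subset_eq)
      qed
      finally show ?thesis .
    qed
    also have "\<dots> \<le> (\<integral>r. v r * c \<partial>\<nu>)"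
      using width(2) v v_nonneg
      by (intro integral_mono' integrable_mult_left mult_left_mono mult_nonneg_nonneg)
         (auto intro: order_trans[OF measure_nonneg])
    finally show ?thesis by (simp add: mult.commute)
  qed
  finally show "(\<integral>\<omega>. (\<integral>s. D s \<omega> \<partial>\<nu>)\<^sup>2 \<partial>M) \<le> c * (\<integral>s. v s \<partial>\<nu>)" by simp
qed

section \<open>Prediction from the past\<close>

context prob_space
begin

text \<open>The series of the squares has a finite expectation, so it converges almost surely; this replaces
Chebyshev followed by Borel--Cantelli.\<close>

lemma AE_tendsto_0_if_summable_second_moments:
  fixes A :: "nat \<Rightarrow> 'a \<Rightarrow> real"
  assumes int: "\<And>n. integrable M (\<lambda>\<omega>. (A n \<omega>)\<^sup>2)"
    and le: "\<And>n. expectation (\<lambda>\<omega>. (A n \<omega>)\<^sup>2) \<le> b n" and b: "summable b"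
  shows "AE \<omega> in M. (\<lambda>n. A n \<omega>) \<longlonglongrightarrow> 0"
proof -
  have b_nonneg: "0 \<le> b n" for n
    by (rule order_trans[OF _ le]) simp
  have [measurable]: "(\<lambda>\<omega>. (A n \<omega>)\<^sup>2) \<in> borel_measurable M" for n
    using int by blast
  have "(\<integral>\<^sup>+\<omega>. (\<Sum>n. ennreal ((A n \<omega>)\<^sup>2)) \<partial>M) = (\<Sum>n. \<integral>\<^sup>+\<omega>. ennreal ((A n \<omega>)\<^sup>2) \<partial>M)"
    by (rule nn_integral_suminf) measurable
  also have "\<dots> = (\<Sum>n. ennreal (expectation (\<lambda>\<omega>. (A n \<omega>)\<^sup>2)))"
    by (intro suminf_cong nn_integral_eq_integral int) auto
  also have "\<dots> \<le> (\<Sum>n. ennreal (b n))"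
    by (intro suminf_le ennreal_leI le) auto
  also have "\<dots> = ennreal (suminf b)"
    by (rule suminf_ennreal_eq) (use b_nonneg b in \<open>auto simp: summable_sums\<close>)
  finally have "(\<integral>\<^sup>+\<omega>. (\<Sum>n. ennreal ((A n \<omega>)\<^sup>2)) \<partial>M) \<noteq> \<infinity>"
    by (auto simp: top_unique)
  then have "AE \<omega> in M. (\<Sum>n. ennreal ((A n \<omega>)\<^sup>2)) \<noteq> \<infinity>"
    by (intro nn_integral_PInf_AE) auto
  then show ?thesis
  proof eventually_elim
    case (elim \<omega>)
    then have "summable (\<lambda>n. (A n \<omega>)\<^sup>2)"
      by (intro summable_suminf_not_top) auto
    then have "(\<lambda>n. (A n \<omega>)\<^sup>2) \<longlonglongrightarrow> 0"
      by (rule summable_LIMSEQ_zero)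
    from tendsto_real_sqrt[OF this] show ?case
      by (simp add: tendsto_rabs_zero_iff)
  qed
qed

text \<open>
The past \<^term>\<open>U\<close> and the normalized increment \<^term>\<open>Z\<close> live in different spaces; their
independence is expressed by the joint law being a product. Fubini for this product stands in for
conditional expectation given the past: \<open>g\<close> below is \<open>E (F(U, Z) | U)\<close> as a function of the past.
\<close>

context
  fixes N :: "'u measure" and U :: "'a \<Rightarrow> 'u" and Z :: "'a \<Rightarrow> real"
  assumes U [measurable]: "U \<in> measurable M N" and Z [measurable]: "Z \<in> borel_measurable M"
    and joint_law: "distr M (N \<Otimes>\<^sub>M borel) (\<lambda>\<omega>. (U \<omega>, Z \<omega>)) = distr M N U \<Otimes>\<^sub>M std_normal"
begin

lemma nn_integral_indep:
  assumes [measurable]: "case_prod G \<in> borel_measurable (N \<Otimes>\<^sub>M borel)"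
  shows "(\<integral>\<^sup>+\<omega>. G (U \<omega>) (Z \<omega>) \<partial>M) = (\<integral>\<^sup>+u. (\<integral>\<^sup>+z. G u z \<partial>std_normal) \<partial>distr M N U)"
proof -
  have "(\<integral>\<^sup>+\<omega>. G (U \<omega>) (Z \<omega>) \<partial>M)
      = (\<integral>\<^sup>+p. case_prod G p \<partial>distr M (N \<Otimes>\<^sub>M borel) (\<lambda>\<omega>. (U \<omega>, Z \<omega>)))"
    by (subst nn_integral_distr) auto
  also have "\<dots> = (\<integral>\<^sup>+u. (\<integral>\<^sup>+z. G u z \<partial>std_normal) \<partial>distr M N U)"
    unfolding joint_law by (subst std_normal.nn_integral_fst[symmetric]) auto
  finally show ?thesis .
qed

context
  fixes F :: "'u \<Rightarrow> real \<Rightarrow> real"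
  assumes F [measurable]: "case_prod F \<in> borel_measurable (N \<Otimes>\<^sub>M borel)"
begin

text \<open>For each value of the past, the variance is at most the second moment.\<close>

lemma centered_square_le:
  assumes int: "\<And>u. integrable std_normal (F u)" "\<And>u. integrable std_normal (\<lambda>z. (F u z)\<^sup>2)"
    and g: "\<And>u. g u = (\<integral>z. F u z \<partial>std_normal)"
  shows "(\<integral>\<^sup>+\<omega>. ennreal ((F (U \<omega>) (Z \<omega>) - g (U \<omega>))\<^sup>2) \<partial>M) \<le> (\<integral>\<^sup>+\<omega>. ennreal ((F (U \<omega>) (Z \<omega>))\<^sup>2) \<partial>M)"
proof -
  have [measurable]: "g \<in> borel_measurable N"
    unfolding g by measurable
  have var: "(\<integral>\<^sup>+z. ennreal ((F u z - g u)\<^sup>2) \<partial>std_normal) \<le> (\<integral>\<^sup>+z. ennreal ((F u z)\<^sup>2) \<partial>std_normal)" for u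
  proof -
    have i: "integrable std_normal (\<lambda>z. (F u z - g u)\<^sup>2)"
      using int by (auto simp: power2_diff)
    have "(\<integral>z. (F u z - g u)\<^sup>2 \<partial>std_normal) \<le> (\<integral>z. (F u z)\<^sup>2 \<partial>std_normal)"
      using std_normal.variance_eq[OF int, of u] by (simp add: g)
    then show ?thesis
      using i int by (simp add: nn_integral_eq_integral ennreal_leI)
  qed
  show ?thesis
    using nn_integral_indep[of "\<lambda>u z. ennreal ((F u z - g u)\<^sup>2)"]
      nn_integral_indep[of "\<lambda>u z. ennreal ((F u z)\<^sup>2)"]
    by (simp add: nn_integral_mono var)
qed

text \<open>The part of \<open>F(U, Z)\<close> that the past does not predict is uncorrelated with every function of the past.\<close>

lemma centered_orthogonal:
  assumes int: "\<And>u. integrable std_normal (F u)"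
    and g: "\<And>u. g u = (\<integral>z. F u z \<partial>std_normal)"
    and K [measurable]: "K \<in> borel_measurable N"
    and KF: "integrable M (\<lambda>\<omega>. K (U \<omega>) * (F (U \<omega>) (Z \<omega>) - g (U \<omega>)))"
  shows "expectation (\<lambda>\<omega>. K (U \<omega>) * (F (U \<omega>) (Z \<omega>) - g (U \<omega>))) = 0"
proof -
  interpret U: prob_space "distr M N U" by (rule prob_space_distr) simp
  interpret pair_sigma_finite "distr M N U" std_normal ..
  have [measurable]: "g \<in> borel_measurable N"
    unfolding g by measurable
  let ?G = "\<lambda>(u, z). K u * (F u z - g u)"
  have "integrable (distr M N U \<Otimes>\<^sub>M std_normal) ?G"
    unfolding joint_law[symmetric] by (subst integrable_distr_eq) (use KF in auto)
  then have "(\<integral>p. ?G p \<partial>(distr M N U \<Otimes>\<^sub>M std_normal)) = (\<integral>u. (\<integral>z. ?G (u, z) \<partial>std_normal) \<partial>distr M N U)"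
    by (rule integral_fst'[symmetric])
  also have "\<dots> = 0"
    using int std_normal.prob_space by (simp add: g)
  finally show ?thesis
    unfolding joint_law[symmetric] by (subst (asm) integral_distr) auto
qed

end

end

end

section \<open>Brownian motion with continuous paths\<close>

text \<open>Only what the moment estimates need of a Brownian motion, for a version all of whose paths are
continuous on the whole line; without exceptional paths the process is jointly measurable, which
Fubini requires. The last assumption involves two earlier times because correlations of two
increments are to be computed.\<close>

locale continuous_brownian_motion = prob_space M
  for M :: "'a measure" and W :: "real \<Rightarrow> 'a \<Rightarrow> real" +
  assumes random_variable_W [measurable]: "\<And>t. W t \<in> borel_measurable M"
    and continuous_W: "\<And>\<omega>. continuous_on UNIV (\<lambda>t. W t \<omega>)"
    and marginal: "\<And>s. 0 < s \<Longrightarrow> distributed M lborel (W s) (normal_density 0 (sqrt s))"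
    and increment: "\<And>s e. 0 \<le> s \<Longrightarrow> 0 < e \<Longrightarrow>
      distr M borel (\<lambda>\<omega>. (W (s + e) \<omega> - W s \<omega>) / sqrt e) = std_normal"
    and past_law: "\<And>r r' s e. 0 \<le> r \<Longrightarrow> r \<le> r' \<Longrightarrow> r' \<le> s \<Longrightarrow> 0 < e \<Longrightarrow>
      distr M ((borel \<Otimes>\<^sub>M borel \<Otimes>\<^sub>M borel) \<Otimes>\<^sub>M borel)
          (\<lambda>\<omega>. ((W r \<omega>, W r' \<omega>, W s \<omega>), (W (s + e) \<omega> - W s \<omega>) / sqrt e))
        = distr M (borel \<Otimes>\<^sub>M borel \<Otimes>\<^sub>M borel) (\<lambda>\<omega>. (W r \<omega>, W r' \<omega>, W s \<omega>)) \<Otimes>\<^sub>M std_normal"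
begin

text \<open>The path is the limit of its values at the grid points just before the given time, and for each mesh
size only countably many grid points occur.\<close>

lemma jointly_measurable_W [measurable]: "case_prod W \<in> borel_measurable (borel \<Otimes>\<^sub>M M)"
proof (rule borel_measurable_LIMSEQ_real)
  fix p :: "real \<times> 'a"
  define q where "q n = of_int \<lfloor>fst p * real (Suc n)\<rfloor> / real (Suc n)" for n
  have "(\<lambda>n. q n) \<longlonglongrightarrow> fst p"
  proof (rule LIMSEQ_I)
    fix e :: real assume "0 < e"
    then obtain m where m: "inverse (real (Suc m)) < e" by (metis reals_Archimedean)
    have "norm (q n - fst p) < e" if "m \<le> n" for n
    proof -
      have "\<bar>q n - fst p\<bar> * real (Suc n) = \<bar>(q n - fst p) * real (Suc n)\<bar>"
        by (simp add: abs_mult)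
      also have "\<dots> = \<bar>of_int \<lfloor>fst p * real (Suc n)\<rfloor> - fst p * real (Suc n)\<bar>"
        by (simp add: q_def left_diff_distrib del: of_nat_Suc)
      also have "\<dots> \<le> 1" by linarith
      finally have "\<bar>q n - fst p\<bar> \<le> inverse (real (Suc n))"
        by (simp add: field_simps del: of_nat_Suc)
      also have "\<dots> \<le> inverse (real (Suc m))"
        using that by (intro le_imp_inverse_le) auto
      finally show ?thesis using m by simp
    qed
    then show "\<exists>m. \<forall>n\<ge>m. norm (q n - fst p) < e" by blast
  qed
  then have "(\<lambda>n. W (q n) (snd p)) \<longlonglongrightarrow> W (fst p) (snd p)"
    using continuous_W[of "snd p"] by (auto simp: continuous_on_eq_continuous_at intro: isCont_tendsto_compose[where g="\<lambda>t. W t (snd p)"])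
  then show "(\<lambda>n. W (of_int \<lfloor>fst p * real (Suc n)\<rfloor> / real (Suc n)) (snd p)) \<longlonglongrightarrow> case_prod W p"
    by (simp add: q_def case_prod_beta')
next
  fix n
  show "(\<lambda>p. W (of_int \<lfloor>fst p * real (Suc n)\<rfloor> / real (Suc n)) (snd p)) \<in> borel_measurable (borel \<Otimes>\<^sub>M M)"
    by (rule measurable_compose_countable[where f="\<lambda>i p. W (of_int i / real (Suc n)) (snd p)"]) measurable
qed

lemma distr_W: "0 < s \<Longrightarrow> distr M borel (W s) = density lborel (\<lambda>u. ennreal (normal_density 0 (sqrt s) u))"
  using distributed_distr_eq_density[OF marginal, of s] by (simp cong: distr_cong)

lemma present_law:
  assumes "0 \<le> s" "0 < e"
  shows "distr M (borel \<Otimes>\<^sub>M borel) (\<lambda>\<omega>. (W s \<omega>, (W (s + e) \<omega> - W s \<omega>) / sqrt e))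
    = distr M borel (W s) \<Otimes>\<^sub>M std_normal"
proof -
  let ?U = "\<lambda>\<omega>. (W s \<omega>, W s \<omega>, W s \<omega>)" and ?Z = "\<lambda>\<omega>. (W (s + e) \<omega> - W s \<omega>) / sqrt e"
  let ?N = "borel \<Otimes>\<^sub>M borel \<Otimes>\<^sub>M borel :: (real \<times> real \<times> real) measure"
  have "distr M (borel \<Otimes>\<^sub>M borel) (\<lambda>\<omega>. (W s \<omega>, ?Z \<omega>))
      = distr (distr M (?N \<Otimes>\<^sub>M borel) (\<lambda>\<omega>. (?U \<omega>, ?Z \<omega>))) (borel \<Otimes>\<^sub>M borel) (\<lambda>(u, z). (fst u, z))"
    by (subst distr_distr) (auto simp: comp_def)
  also have "distr M (?N \<Otimes>\<^sub>M borel) (\<lambda>\<omega>. (?U \<omega>, ?Z \<omega>)) = distr M ?N ?U \<Otimes>\<^sub>M std_normal"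
    using past_law[of s s s e] assms by simp
  also have "distr (distr M ?N ?U \<Otimes>\<^sub>M std_normal) (borel \<Otimes>\<^sub>M borel) (\<lambda>(u, z). (fst u, z))
      = distr (distr M ?N ?U) borel fst \<Otimes>\<^sub>M distr std_normal borel (\<lambda>z. z)"
    by (rule pair_measure_distr[symmetric])
       (auto intro!: prob_space_imp_sigma_finite std_normal.prob_space_distr)
  also have "distr (distr M ?N ?U) borel fst = distr M borel (W s)"
    by (subst distr_distr) (auto simp: comp_def)
  also have "distr std_normal borel (\<lambda>z. z) = std_normal"
    by (rule distr_id2) simp
  finally show ?thesis .
qed

lemma measurable_path [measurable]: "(\<lambda>t. W t \<omega>) \<in> borel_measurable borel"
  using continuous_W by (rule borel_measurable_continuous_onI)

end

section \<open>Crossings and their prediction\<close>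

lemma LBINT_inverse_sqrt:
  fixes t :: real assumes "0 < t"
  shows "set_integrable lborel {0<..<t} (\<lambda>s. 1 / sqrt s)"
    and "(LBINT s:{0<..<t}. 1 / sqrt s) = 2 * sqrt t"
proof -
  have F: "((\<lambda>s. 2 * sqrt s) has_real_derivative 1 / sqrt s) (at s)" if "0 < s" for s :: real
    using that by (auto intro!: derivative_eq_intros simp: field_simps)
  have lims: "(((\<lambda>s. 2 * sqrt s) \<circ> real_of_ereal) \<longlongrightarrow> 2 * sqrt 0) (at_right (ereal 0))"
      "(((\<lambda>s. 2 * sqrt s) \<circ> real_of_ereal) \<longlongrightarrow> 2 * sqrt t) (at_left (ereal t))"
    unfolding ereal_tendsto_simps by (intro tendsto_intros)+
  note FTC = interval_integral_FTC_nonneg[where F="\<lambda>s. 2 * sqrt s", OF _ _ _ _ lims]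
  have "set_integrable lborel (einterval (ereal 0) (ereal t)) (\<lambda>s. 1 / sqrt s)"
    by (rule FTC) (use assms F in \<open>auto intro!: continuous_intros\<close>)
  moreover have "(LBINT s=ereal 0..ereal t. 1 / sqrt s) = 2 * sqrt t - 2 * sqrt 0"
    by (rule FTC) (use assms F in \<open>auto intro!: continuous_intros\<close>)
  ultimately show "set_integrable lborel {0<..<t} (\<lambda>s. 1 / sqrt s)"
    "(LBINT s:{0<..<t}. 1 / sqrt s) = 2 * sqrt t"
    using assms by (simp_all add: interval_lebesgue_integral_def)
qed

locale brownian_crossing = continuous_brownian_motion M W + crossing_kernel h
  for M :: "'a measure" and W :: "real \<Rightarrow> 'a \<Rightarrow> real" and h :: "real \<Rightarrow> real \<Rightarrow> real"
begin

definition crossing :: "real \<Rightarrow> real \<Rightarrow> real \<Rightarrow> 'a \<Rightarrow> real" where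
  "crossing e x s \<omega> = h (W s \<omega> - x) (W (s + e) \<omega> - W s \<omega>)"

text \<open>The conditional expectation of \<open>crossing\<close> given the past up to time \<^term>\<open>s\<close>.\<close>

definition predicted :: "real \<Rightarrow> real \<Rightarrow> real \<Rightarrow> 'a \<Rightarrow> real" where
  "predicted e x s \<omega> = sqrt e * profile ((W s \<omega> - x) / sqrt e)"

definition deviation :: "real \<Rightarrow> real \<Rightarrow> real \<Rightarrow> 'a \<Rightarrow> real" where
  "deviation e x s \<omega> = crossing e x s \<omega> - predicted e x s \<omega>"

lemma measurable_crossing [measurable]: "case_prod (crossing e x) \<in> borel_measurable (borel \<Otimes>\<^sub>M M)"
  unfolding crossing_def by measurable

lemma measurable_predicted [measurable]: "case_prod (predicted e x) \<in> borel_measurable (borel \<Otimes>\<^sub>M M)"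
  unfolding predicted_def by measurable

lemma measurable_deviation [measurable]: "case_prod (deviation e x) \<in> borel_measurable (borel \<Otimes>\<^sub>M M)"
  unfolding deviation_def by measurable

lemma crossing_normalized:
  "0 < e \<Longrightarrow> crossing e x s \<omega> = h (W s \<omega> - x) (sqrt e * ((W (s + e) \<omega> - W s \<omega>) / sqrt e))"
  by (simp add: crossing_def)

lemma predicted_eq_integral:
  "0 < e \<Longrightarrow> predicted e x s \<omega> = (\<integral>z. h (W s \<omega> - x) (sqrt e * z) \<partial>std_normal)"
  by (simp add: predicted_def profile_scaled)

definition moment_const :: real where "moment_const = 2 * third_moment / sqrt (2 * pi)"

lemma moment_const_nonneg: "0 \<le> moment_const"
  by (simp add: moment_const_def third_moment_nonneg)

text \<open>Given an increment of length \<open>sqrt e * \<bar>z\<bar>\<close>, the position must lie within that distance of the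
level, and the density of the position at time \<^term>\<open>s\<close> is at most \<open>1 / sqrt (2 * pi * s)\<close>. This
probability of order at most \<open>sqrt (e / s)\<close>, on top of the order \<open>e\<close> of the squared increment, is what
makes the final error summable.\<close>

lemma crossing_second_moment:
  assumes s: "0 < s" and e: "0 < e"
  shows "(\<integral>\<^sup>+\<omega>. ennreal ((crossing e x s \<omega>)\<^sup>2) \<partial>M) \<le> ennreal (moment_const * (e * sqrt e) / sqrt s)"
proof -
  interpret pair_sigma_finite lborel std_normal ..
  define F where "F u z = h (u - x) (sqrt e * z)" for u z
  define c where "c = 1 / (sqrt (2 * pi) * sqrt s)"
  have c: "0 \<le> c" using s by (simp add: c_def)
  have [measurable]: "case_prod F \<in> borel_measurable (borel \<Otimes>\<^sub>M borel)"
    unfolding F_def by measurable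
  have dens: "normal_density 0 (sqrt s) u \<le> c" for u
    using s by (auto simp: normal_density_def c_def real_sqrt_mult intro!: divide_right_mono)
  have slice: "(\<integral>\<^sup>+u. ennreal ((F u z)\<^sup>2) \<partial>lborel) \<le> ennreal (2 * (e * sqrt e) * \<bar>z\<bar> ^ 3)" for z
  proof -
    have "(F u z)\<^sup>2 \<le> e * z\<^sup>2 * indicator {x - sqrt e * \<bar>z\<bar>..x + sqrt e * \<bar>z\<bar>} u" for u
    proof (cases "\<bar>u - x\<bar> \<le> sqrt e * \<bar>z\<bar>")
      case True
      then have "indicator {x - sqrt e * \<bar>z\<bar>..x + sqrt e * \<bar>z\<bar>} u = (1::real)"
        by (simp add: abs_le_iff algebra_simps)
      then show ?thesis
        using power_mono[OF kernel_le kernel_nonneg, of "u - x" "sqrt e * z" 2] e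
        by (simp add: F_def power_mult_distrib)
    next
      case False
      then have "F u z = 0"
        unfolding F_def using e by (intro kernel_support) (simp add: abs_mult)
      then show ?thesis using e by simp
    qed
    then have "(\<integral>\<^sup>+u. ennreal ((F u z)\<^sup>2) \<partial>lborel)
        \<le> (\<integral>\<^sup>+u. ennreal (e * z\<^sup>2) * indicator {x - sqrt e * \<bar>z\<bar>..x + sqrt e * \<bar>z\<bar>} u \<partial>lborel)"
      using e by (intro nn_integral_mono) (auto simp: ennreal_mult'[symmetric] ennreal_leI simp flip: ennreal_indicator)
    also have "\<dots> = ennreal (e * z\<^sup>2) * ennreal (2 * sqrt e * \<bar>z\<bar>)"
      using e by (subst nn_integral_cmult_indicator) (auto simp: mult_ac)
    also have "\<dots> = ennreal (2 * (e * sqrt e) * \<bar>z\<bar> ^ 3)"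
    proof -
      have "z\<^sup>2 * \<bar>z\<bar> = \<bar>z\<bar> ^ 3"
        by (simp add: power3_eq_cube power2_eq_square)
      then have "(e * z\<^sup>2) * (2 * sqrt e * \<bar>z\<bar>) = 2 * (e * sqrt e) * \<bar>z\<bar> ^ 3"
        by (metis mult.assoc mult.commute mult.left_commute)
      then show ?thesis
        using e by (metis ennreal_mult' less_imp_le mult_nonneg_nonneg zero_le_power2)
    qed
    finally show ?thesis .
  qed
  have "(\<integral>\<^sup>+\<omega>. ennreal ((crossing e x s \<omega>)\<^sup>2) \<partial>M)
      = (\<integral>\<^sup>+\<omega>. ennreal ((F (W s \<omega>) ((W (s + e) \<omega> - W s \<omega>) / sqrt e))\<^sup>2) \<partial>M)"
    using e by (simp add: F_def crossing_normalized)
  also have "\<dots> = (\<integral>\<^sup>+u. (\<integral>\<^sup>+z. ennreal ((F u z)\<^sup>2) \<partial>std_normal) \<partial>distr M borel (W s))"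
    using s e by (intro nn_integral_indep[where G="\<lambda>u z. ennreal ((F u z)\<^sup>2)"] present_law) auto
  also have "\<dots> = (\<integral>\<^sup>+u. ennreal (normal_density 0 (sqrt s) u) * (\<integral>\<^sup>+z. ennreal ((F u z)\<^sup>2) \<partial>std_normal) \<partial>lborel)"
    using s by (simp add: distr_W nn_integral_density)
  also have "\<dots> \<le> (\<integral>\<^sup>+u. ennreal c * (\<integral>\<^sup>+z. ennreal ((F u z)\<^sup>2) \<partial>std_normal) \<partial>lborel)"
    by (intro nn_integral_mono mult_right_mono ennreal_leI dens) auto
  also have "\<dots> = ennreal c * (\<integral>\<^sup>+z. (\<integral>\<^sup>+u. ennreal ((F u z)\<^sup>2) \<partial>lborel) \<partial>std_normal)"
    by (simp add: nn_integral_cmult Fubini'[of "\<lambda>u z. ennreal ((F u z)\<^sup>2)"])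
  also have "\<dots> \<le> ennreal c * (\<integral>\<^sup>+z. ennreal (2 * (e * sqrt e)) * ennreal (\<bar>z\<bar> ^ 3) \<partial>std_normal)"
    using slice e by (intro mult_left_mono nn_integral_mono) (auto simp: ennreal_mult)
  also have "\<dots> = ennreal c * (ennreal (2 * (e * sqrt e)) * ennreal third_moment)"
    by (simp add: nn_integral_cmult nn_integral_std_normal_abs_cubed)
  also have "\<dots> = ennreal (moment_const * (e * sqrt e) / sqrt s)"
    using e c third_moment_nonneg
    by (auto simp: c_def moment_const_def simp flip: ennreal_mult)
  finally show ?thesis .
qed

lemma deviation_second_moment:
  assumes s: "0 < s" and e: "0 < e"
  shows "integrable M (\<lambda>\<omega>. (deviation e x s \<omega>)\<^sup>2)"
    and "expectation (\<lambda>\<omega>. (deviation e x s \<omega>)\<^sup>2) \<le> moment_const * (e * sqrt e) / sqrt s"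
proof -
  let ?F = "\<lambda>u z. h (u - x) (sqrt e * z)"
  let ?Z = "\<lambda>\<omega>. (W (s + e) \<omega> - W s \<omega>) / sqrt e"
  have "(\<integral>\<^sup>+\<omega>. ennreal ((deviation e x s \<omega>)\<^sup>2) \<partial>M)
      = (\<integral>\<^sup>+\<omega>. ennreal ((?F (W s \<omega>) (?Z \<omega>) - (\<integral>z. ?F (W s \<omega>) z \<partial>std_normal))\<^sup>2) \<partial>M)"
    using e by (simp add: deviation_def crossing_normalized predicted_eq_integral)
  also have "\<dots> \<le> (\<integral>\<^sup>+\<omega>. ennreal ((?F (W s \<omega>) (?Z \<omega>))\<^sup>2) \<partial>M)"
    using s e
    by (intro centered_square_le[where F="?F" and N=borel] present_law kernel_integrable kernel_power_integrable) auto
  also have "\<dots> \<le> ennreal (moment_const * (e * sqrt e) / sqrt s)"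
    using crossing_second_moment[OF s e, of x] e by (simp add: crossing_normalized)
  finally have *: "(\<integral>\<^sup>+\<omega>. ennreal ((deviation e x s \<omega>)\<^sup>2) \<partial>M) \<le> ennreal (moment_const * (e * sqrt e) / sqrt s)" .
  show int: "integrable M (\<lambda>\<omega>. (deviation e x s \<omega>)\<^sup>2)"
    using * by (intro integrableI_nonneg) (auto simp: le_less_trans)
  show "expectation (\<lambda>\<omega>. (deviation e x s \<omega>)\<^sup>2) \<le> moment_const * (e * sqrt e) / sqrt s"
    using * s e moment_const_nonneg by (subst (asm) nn_integral_eq_integral[OF int]) auto
qed

text \<open>If the two windows do not overlap, then the earlier deviation is a function of the past of the later
one.\<close>

lemma deviation_orthogonal:
  assumes r: "0 < r" and s: "r + e \<le> s" and e: "0 < e"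
  shows "expectation (\<lambda>\<omega>. deviation e x r \<omega> * deviation e x s \<omega>) = 0"
proof -
  let ?N = "borel \<Otimes>\<^sub>M borel \<Otimes>\<^sub>M borel :: (real \<times> real \<times> real) measure"
  let ?U = "\<lambda>\<omega>. (W r \<omega>, W (r + e) \<omega>, W s \<omega>)"
  let ?Z = "\<lambda>\<omega>. (W (s + e) \<omega> - W s \<omega>) / sqrt e"
  let ?F = "\<lambda>u z. h (snd (snd u) - x) (sqrt e * z)"
  let ?g = "\<lambda>u. \<integral>z. ?F u z \<partial>std_normal"
  let ?K = "\<lambda>u. h (fst u - x) (fst (snd u) - fst u) - sqrt e * profile ((fst u - x) / sqrt e)"
  have K: "deviation e x r \<omega> = ?K (?U \<omega>)" for \<omega>
    by (simp add: deviation_def crossing_def predicted_def)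
  have F: "deviation e x s \<omega> = ?F (?U \<omega>) (?Z \<omega>) - ?g (?U \<omega>)" for \<omega>
    using e by (simp add: deviation_def crossing_normalized predicted_eq_integral)
  have "integrable M (\<lambda>\<omega>. deviation e x r \<omega> * deviation e x s \<omega>)"
  proof (rule Bochner_Integration.integrable_bound)
    show "integrable M (\<lambda>\<omega>. (deviation e x r \<omega>)\<^sup>2 + (deviation e x s \<omega>)\<^sup>2)"
      using assms by (intro Bochner_Integration.integrable_add deviation_second_moment) auto
    have "\<bar>a * b\<bar> \<le> a\<^sup>2 + b\<^sup>2" for a b :: real
      using sum_squares_bound[of "\<bar>a\<bar>" "\<bar>b\<bar>"] mult_nonneg_nonneg[of "\<bar>a\<bar>" "\<bar>b\<bar>"]
      unfolding abs_mult power2_abs by linarith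
    then show "AE \<omega> in M. norm (deviation e x r \<omega> * deviation e x s \<omega>)
        \<le> norm ((deviation e x r \<omega>)\<^sup>2 + (deviation e x s \<omega>)\<^sup>2)"
      by simp
  qed measurable
  then have *: "integrable M (\<lambda>\<omega>. ?K (?U \<omega>) * (?F (?U \<omega>) (?Z \<omega>) - ?g (?U \<omega>)))"
    unfolding K F .
  have "expectation (\<lambda>\<omega>. ?K (?U \<omega>) * (?F (?U \<omega>) (?Z \<omega>) - ?g (?U \<omega>))) = 0"
  proof (rule centered_orthogonal[where N="?N" and U="?U" and Z="?Z" and F="?F" and g="?g" and K="?K"])
    show "distr M (?N \<Otimes>\<^sub>M borel) (\<lambda>\<omega>. (?U \<omega>, ?Z \<omega>)) = distr M ?N ?U \<Otimes>\<^sub>M std_normal"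
      using assms by (intro past_law) auto
    show "integrable std_normal (?F u)" for u
      by (rule kernel_integrable)
    show "?K \<in> borel_measurable ?N" by measurable
    show "?U \<in> measurable M ?N" "?Z \<in> borel_measurable M" by measurable
    show "case_prod ?F \<in> borel_measurable (?N \<Otimes>\<^sub>M borel)" by measurable
    show "integrable M (\<lambda>\<omega>. ?K (?U \<omega>) * (?F (?U \<omega>) (?Z \<omega>) - ?g (?U \<omega>)))" by (fact *)
  qed (rule refl)
  then show ?thesis unfolding K F .
qed

text \<open>The singularity \<open>1 / sqrt s\<close> of the bound at time 0 is integrable. The open interval avoids time 0,
where the position has no density.\<close>

lemma integrated_deviation_second_moment:
  assumes t: "0 < t" and e: "0 < e"
  shows "integrable M (\<lambda>\<omega>. (LBINT s:{0<..<t}. deviation e x s \<omega>)\<^sup>2)"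
    and "expectation (\<lambda>\<omega>. (LBINT s:{0<..<t}. deviation e x s \<omega>)\<^sup>2)
      \<le> 2 * e * (moment_const * (e * sqrt e) * (2 * sqrt t))"
proof -
  let ?T = "restrict_space lborel {0<..<t}"
  let ?v = "\<lambda>s. moment_const * (e * sqrt e) * (1 / sqrt s)"
  let ?R = "{p \<in> space (?T \<Otimes>\<^sub>M ?T). \<bar>fst p - snd p\<bar> < e}"
  have spT: "space ?T = {0<..<t}" by (simp add: space_restrict_space)
  have fin: "finite_measure ?T"
    using t by (intro finite_measureI) (simp add: spT emeasure_restrict_space)
  have idT [measurable]: "(\<lambda>s. s) \<in> borel_measurable ?T"
    by (rule measurable_restrict_space1) simp
  have meas: "case_prod (deviation e x) \<in> borel_measurable (?T \<Otimes>\<^sub>M M)"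
  proof -
    have "(\<lambda>p. case_prod (deviation e x) (fst p, snd p)) \<in> borel_measurable (?T \<Otimes>\<^sub>M M)"
      by (rule measurable_compose[OF _ measurable_deviation]) measurable
    then show ?thesis by simp
  qed
  have v: "integrable ?T ?v" "(\<integral>s. ?v s \<partial>?T) = moment_const * (e * sqrt e) * (2 * sqrt t)"
    using LBINT_inverse_sqrt[OF t]
    by (auto simp: integrable_restrict_space integral_restrict_space set_integrable_def
          set_lebesgue_integral_def simp del: times_divide_eq_right)
  have ball: "measure ?T {q \<in> space ?T. \<bar>p - q\<bar> < e} \<le> 2 * e" for p
  proof -
    have "measure ?T {q \<in> space ?T. \<bar>p - q\<bar> < e} = measure lborel {q \<in> {0<..<t}. \<bar>p - q\<bar> < e}"
      by (subst measure_restrict_space) (auto simp: spT)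
    also have "\<dots> \<le> measure lborel {p - e..p + e}"
      using e by (intro measure_mono_fmeasurable) (auto simp: abs_less_iff fmeasurable_def)
    also have "\<dots> = 2 * e" using e by simp
    finally show ?thesis .
  qed
  have R: "?R \<in> sets (?T \<Otimes>\<^sub>M ?T)" by measurable
  have "{s \<in> space ?T. (r, s) \<in> ?R} = {q \<in> space ?T. \<bar>r - q\<bar> < e}"
    "{s \<in> space ?T. (s, r) \<in> ?R} = {q \<in> space ?T. \<bar>r - q\<bar> < e}" if "r \<in> space ?T" for r
    using that by (auto simp: space_pair_measure)
  with ball have width: "measure ?T {s \<in> space ?T. (r, s) \<in> ?R} \<le> 2 * e"
    "measure ?T {s \<in> space ?T. (s, r) \<in> ?R} \<le> 2 * e" if "r \<in> space ?T" for r
    using that by simp_all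
  have orth: "expectation (\<lambda>\<omega>. deviation e x r \<omega> * deviation e x s \<omega>) = 0"
    if "r \<in> space ?T" "s \<in> space ?T" "(r, s) \<notin> ?R" for r s
  proof -
    have "0 < r" "0 < s" "r + e \<le> s \<or> s + e \<le> r"
      using that by (auto simp: spT space_pair_measure)
    then show ?thesis
      using deviation_orthogonal[of r e s x] deviation_orthogonal[of s e r x] e by (auto simp: mult.commute)
  qed
  have eq: "(LBINT s:{0<..<t}. deviation e x s \<omega>) = (\<integral>s. deviation e x s \<omega> \<partial>?T)" for \<omega>
    by (simp add: set_lebesgue_integral_def integral_restrict_space)
  have D2: "integrable M (\<lambda>\<omega>. (deviation e x s \<omega>)\<^sup>2)"
    "expectation (\<lambda>\<omega>. (deviation e x s \<omega>)\<^sup>2) \<le> ?v s" if "s \<in> space ?T" for s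
    using deviation_second_moment[of s e x] that e by (auto simp: spT)
  note * = short_range_second_moment[OF fin finite_measure_axioms meas v(1) D2 R width orth, simplified v(2)]
  show "integrable M (\<lambda>\<omega>. (LBINT s:{0<..<t}. deviation e x s \<omega>)\<^sup>2)"
    unfolding eq using * by blast
  show "expectation (\<lambda>\<omega>. (LBINT s:{0<..<t}. deviation e x s \<omega>)\<^sup>2)
      \<le> 2 * e * (moment_const * (e * sqrt e) * (2 * sqrt t))"
    unfolding eq using * by blast
qed

text \<open>After division by \<open>e\<^sup>2\<close>, the second moment is at most of order \<open>sqrt e\<close>, which is why the square roots of the
window lengths have to be summable.\<close>

lemma averaged_deviation_tendsto_0:
  fixes \<epsilon> :: "nat \<Rightarrow> real"
  assumes eps: "\<And>n. 0 < \<epsilon> n" and sum: "summable (\<lambda>n. sqrt (\<epsilon> n))" and t: "0 < t"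
  shows "AE \<omega> in M. (\<lambda>n. 1 / \<epsilon> n * (LBINT s:{0<..<t}. deviation (\<epsilon> n) x s \<omega>)) \<longlonglongrightarrow> 0"
proof (rule AE_tendsto_0_if_summable_second_moments)
  note * = integrated_deviation_second_moment[OF t eps, where x=x]
  show "integrable M (\<lambda>\<omega>. (1 / \<epsilon> n * (LBINT s:{0<..<t}. deviation (\<epsilon> n) x s \<omega>))\<^sup>2)" for n
    unfolding power_mult_distrib by (intro integrable_mult_right *)
  show "expectation (\<lambda>\<omega>. (1 / \<epsilon> n * (LBINT s:{0<..<t}. deviation (\<epsilon> n) x s \<omega>))\<^sup>2)
      \<le> 4 * moment_const * sqrt t * sqrt (\<epsilon> n)" for n
  proof -
    have "expectation (\<lambda>\<omega>. (1 / \<epsilon> n * (LBINT s:{0<..<t}. deviation (\<epsilon> n) x s \<omega>))\<^sup>2)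
        \<le> (1 / \<epsilon> n)\<^sup>2 * (2 * \<epsilon> n * (moment_const * (\<epsilon> n * sqrt (\<epsilon> n)) * (2 * sqrt t)))"
      unfolding power_mult_distrib integral_mult_right_zero by (intro mult_left_mono *) auto
    also have "\<dots> = 4 * moment_const * sqrt t * sqrt (\<epsilon> n)"
      using eps[of n] by (simp add: power2_eq_square)
    finally show ?thesis .
  qed
  show "summable (\<lambda>n. 4 * moment_const * sqrt t * sqrt (\<epsilon> n))"
    by (intro summable_mult sum)
qed

end

section \<open>Occupation times and truncated windows\<close>

lemma set_integrable_bounded_Icc:
  fixes f :: "real \<Rightarrow> real"
  assumes [measurable]: "f \<in> borel_measurable borel" and "\<And>s. s \<in> {a..b} \<Longrightarrow> \<bar>f s\<bar> \<le> B"
  shows "set_integrable lborel {a..b} f"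
  unfolding set_integrable_def
  by (rule integrableI_bounded_set_indicator[where B=B])
     (use assms in \<open>auto simp: emeasure_lborel_Icc_eq\<close>)

lemma continuous_bounded_Icc:
  fixes f :: "real \<Rightarrow> real"
  assumes "continuous_on UNIV f"
  shows "\<exists>B. \<forall>s\<in>{a..b}. \<bar>f s\<bar> \<le> B"
proof -
  have "compact (f ` {a..b})"
    by (intro compact_continuous_image continuous_on_subset[OF assms] compact_Icc) auto
  then have "bounded (f ` {a..b})" by (rule compact_imp_bounded)
  then show ?thesis by (auto simp: bounded_iff)
qed

context crossing_kernel
begin

text \<open>The occupation times formula turns the time average into a space average of the local time \<^term>\<open>l\<close>,
which after substitution reads \<open>\<integral>u. profile u * l (x + sqrt e * u)\<close>. Continuity of \<^term>\<open>l\<close> in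
space gives the limit by dominated convergence; \<^term>\<open>l\<close> is essentially bounded since it vanishes
off the range of the path.\<close>

lemma averaged_profile_tendsto:
  fixes w l :: "real \<Rightarrow> real" and \<epsilon> :: "nat \<Rightarrow> real"
  assumes w: "continuous_on UNIV w" and l: "continuous_on UNIV l" and l_nonneg: "\<And>y. 0 \<le> l y"
    and occ: "\<And>g. g \<in> borel_measurable borel \<Longrightarrow>
      (\<integral>\<^sup>+s\<in>{0..t}. g (w s) \<partial>lborel) = (\<integral>\<^sup>+y. g y * ennreal (l y) \<partial>lborel)"
    and eps: "\<And>n. 0 < \<epsilon> n" and lim: "\<epsilon> \<longlonglongrightarrow> 0"
  shows "(\<lambda>n. 1 / \<epsilon> n * (LBINT s:{0..t}. sqrt (\<epsilon> n) * profile ((w s - x) / sqrt (\<epsilon> n)))) \<longlonglongrightarrow> mass * l x"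
proof -
  have [measurable]: "w \<in> borel_measurable borel" "l \<in> borel_measurable borel"
    using w l by (auto intro: borel_measurable_continuous_onI)
  \<comment> \<open>take for \<open>g\<close> in the occupation times formula the indicator of the complement of \<open>[-K, K]\<close>\<close>
  obtain B where B: "AE y in lborel. l y \<le> B"
  proof -
    obtain K where K: "\<And>s. s \<in> {0..t} \<Longrightarrow> \<bar>w s\<bar> \<le> K"
      using continuous_bounded_Icc[OF w] by blast
    obtain B where B: "\<And>y. y \<in> {-K..K} \<Longrightarrow> \<bar>l y\<bar> \<le> B"
      using continuous_bounded_Icc[OF l] by blast
    have "(\<integral>\<^sup>+y. indicator (- {-K..K}) y * ennreal (l y) \<partial>lborel) = (\<integral>\<^sup>+s\<in>{0..t}. indicator (- {-K..K}) (w s) \<partial>lborel)"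
      by (rule occ[symmetric]) measurable
    also have "\<dots> = (\<integral>\<^sup>+(s::real). 0 \<partial>lborel)"
    proof (rule nn_integral_cong)
      show "indicator (- {-K..K}) (w s) * indicator {0..t} s = (0::ennreal)" for s
        using K[of s] by (auto simp: indicator_def abs_le_iff)
    qed
    finally have "(\<integral>\<^sup>+y. indicator (- {-K..K}) y * ennreal (l y) \<partial>lborel) = 0"
      by simp
    then have "AE y in lborel. indicator (- {-K..K}) y * ennreal (l y) = 0"
      by (subst (asm) nn_integral_0_iff_AE) auto
    then have "AE y in lborel. l y \<le> max B 0"
    proof eventually_elim
      case (elim y)
      then show ?case using B[of y] l_nonneg[of y] by (cases "y \<in> {-K..K}") (auto simp: ennreal_eq_0_iff)
    qed
    then show ?thesis by (rule that)
  qed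
  have scaled_B: "AE u in lborel. l (x + c * u) \<le> B" if "c \<noteq> 0" for c
    by (rule AE_borel_affine[OF that _ B]) measurable
  have substitution: "1 / e * (LBINT s:{0..t}. sqrt e * profile ((w s - x) / sqrt e))
      = (\<integral>u. profile u * l (x + sqrt e * u) \<partial>lborel)" if e: "0 < e" for e
  proof -
    let ?p = "\<lambda>y. 1 / e * (sqrt e * profile ((y - x) / sqrt e))"
    have int: "set_integrable lborel {0..t} (\<lambda>s. ?p (w s))"
      using e profile_le profile_nonneg
      by (intro set_integrable_bounded_Icc[where B="1 / e * (sqrt e * (\<integral>z. \<bar>z\<bar> \<partial>std_normal))"])
         (auto simp: abs_mult intro!: divide_right_mono)
    have int': "integrable lborel (\<lambda>u. profile u * l (x + sqrt e * u))"
    proof (rule Bochner_Integration.integrable_bound)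
      show "integrable lborel (\<lambda>u. profile u * B)"
        using integrable_profile by simp
      show "AE u in lborel. norm (profile u * l (x + sqrt e * u)) \<le> norm (profile u * B)"
        using scaled_B[of "sqrt e"] e
        by (auto elim!: eventually_mono simp: abs_mult l_nonneg profile_nonneg
             intro!: mult_left_mono order_trans[OF _ abs_ge_self])
    qed measurable
    have "ennreal (1 / e * (LBINT s:{0..t}. sqrt e * profile ((w s - x) / sqrt e)))
        = ennreal (LBINT s:{0..t}. ?p (w s))"
      by simp
    also have "\<dots> = (\<integral>\<^sup>+s. ennreal (indicator {0..t} s *\<^sub>R ?p (w s)) \<partial>lborel)"
      unfolding set_lebesgue_integral_def
      using int e by (intro nn_integral_eq_integral[symmetric])
        (auto simp: set_integrable_def profile_nonneg)
    also have "\<dots> = (\<integral>\<^sup>+s\<in>{0..t}. ennreal (?p (w s)) \<partial>lborel)"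
      by (intro nn_integral_cong) (auto simp: indicator_def)
    also have "\<dots> = (\<integral>\<^sup>+y. ennreal (?p y) * ennreal (l y) \<partial>lborel)"
      by (rule occ) measurable
    also have "\<dots> = ennreal \<bar>sqrt e\<bar> * (\<integral>\<^sup>+u. ennreal (?p (x + sqrt e * u)) * ennreal (l (x + sqrt e * u)) \<partial>lborel)"
      using e by (intro nn_integral_real_affine) auto
    also have "\<dots> = (\<integral>\<^sup>+u. ennreal (sqrt e) * (ennreal (?p (x + sqrt e * u)) * ennreal (l (x + sqrt e * u))) \<partial>lborel)"
      using e by (subst nn_integral_cmult) auto
    also have "\<dots> = (\<integral>\<^sup>+u. ennreal (profile u * l (x + sqrt e * u)) \<partial>lborel)"
    proof (intro nn_integral_cong)
      fix u
      have "sqrt e * (?p (x + sqrt e * u) * l (x + sqrt e * u))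
          = (sqrt e * sqrt e / e) * (profile u * l (x + sqrt e * u))"
        using e by (simp add: field_simps)
      then have "sqrt e * (?p (x + sqrt e * u) * l (x + sqrt e * u)) = profile u * l (x + sqrt e * u)"
        using e by simp
      then show "ennreal (sqrt e) * (ennreal (?p (x + sqrt e * u)) * ennreal (l (x + sqrt e * u)))
          = ennreal (profile u * l (x + sqrt e * u))"
        using e by (metis (no_types) ennreal_mult' ennreal_mult'' l_nonneg less_imp_le real_sqrt_ge_0_iff)
    qed
    also have "\<dots> = ennreal (\<integral>u. profile u * l (x + sqrt e * u) \<partial>lborel)"
      using int' by (intro nn_integral_eq_integral) (auto simp: profile_nonneg l_nonneg)
    finally show ?thesis
      using e by (subst (asm) ennreal_inj)
        (auto simp: profile_nonneg l_nonneg set_lebesgue_integral_def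
          intro!: integral_nonneg_AE divide_nonneg_nonneg)
  qed
  have "(\<lambda>n. \<integral>u. profile u * l (x + sqrt (\<epsilon> n) * u) \<partial>lborel) \<longlonglongrightarrow> (\<integral>u. profile u * l x \<partial>lborel)"
  proof (rule integral_dominated_convergence)
    show "integrable lborel (\<lambda>u. profile u * B)"
      using integrable_profile by simp
    have "(\<lambda>n. sqrt (\<epsilon> n)) \<longlonglongrightarrow> 0"
      using tendsto_real_sqrt[OF lim] by simp
    then have "(\<lambda>n. x + sqrt (\<epsilon> n) * u) \<longlonglongrightarrow> x + 0 * u" for u
      by (intro tendsto_add tendsto_mult tendsto_const)
    then have "(\<lambda>n. x + sqrt (\<epsilon> n) * u) \<longlonglongrightarrow> x" for u
      by simp
    then have "(\<lambda>n. l (x + sqrt (\<epsilon> n) * u)) \<longlonglongrightarrow> l x" for u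
      using l by (auto simp: continuous_on_eq_continuous_at intro: isCont_tendsto_compose[where g=l])
    then show "AE u in lborel. (\<lambda>n. profile u * l (x + sqrt (\<epsilon> n) * u)) \<longlonglongrightarrow> profile u * l x"
      by (auto intro!: tendsto_mult)
    show "AE u in lborel. norm (profile u * l (x + sqrt (\<epsilon> n) * u)) \<le> profile u * B" for n
      using scaled_B[of "sqrt (\<epsilon> n)"] eps[of n]
      by (auto elim!: eventually_mono simp: abs_mult l_nonneg profile_nonneg intro!: mult_left_mono)
  qed measurable
  then show ?thesis
    unfolding substitution[OF eps] by (simp add: mass_def)
qed

lemma kernel_path_integrable:
  fixes w f :: "real \<Rightarrow> real"
  assumes w: "continuous_on UNIV w" and f: "continuous_on UNIV f"
  shows "set_integrable lborel {a..b} (\<lambda>u. h (w u - x) (w (f u) - w u))"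
proof -
  have [measurable]: "w \<in> borel_measurable borel" "f \<in> borel_measurable borel"
    using w f by (auto intro: borel_measurable_continuous_onI)
  have "continuous_on UNIV (\<lambda>u. w (f u) - w u)"
    by (intro continuous_intros continuous_on_compose2[OF w f] w) auto
  from continuous_bounded_Icc[OF this, of a b]
  obtain B where B: "\<And>u. u \<in> {a..b} \<Longrightarrow> \<bar>w (f u) - w u\<bar> \<le> B"
    by blast
  have "\<bar>h (w u - x) (w (f u) - w u)\<bar> \<le> B" if "u \<in> {a..b}" for u
    using kernel_le[of "w u - x" "w (f u) - w u"] kernel_nonneg[of "w u - x" "w (f u) - w u"] B[OF that]
    by linarith
  then show ?thesis
    by (intro set_integrable_bounded_Icc[where B=B]) auto
qed

text \<open>Truncating the window at \<^term>\<open>t\<close> changes the integrand only for the last stretch of length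
\<^term>\<open>e\<close>, and there both integrands lie between 0 and the modulus of continuity of the path.\<close>

lemma truncated_crossing_close:
  assumes w: "continuous_on UNIV w" and e: "0 < e"
    and osc: "\<And>u v. u \<in> {0..t} \<Longrightarrow> \<bar>u - v\<bar> \<le> e \<Longrightarrow> \<bar>w v - w u\<bar> \<le> d"
    and d: "0 \<le> d"
  shows "\<bar>1 / e * (LBINT u:{0..t}. h (w u - x) (w (min (u + e) t) - w u))
    - 1 / e * (LBINT u:{0..t}. h (w u - x) (w (u + e) - w u))\<bar> \<le> d"
proof -
  let ?f = "\<lambda>u. h (w u - x) (w (min (u + e) t) - w u)" and ?g = "\<lambda>u. h (w u - x) (w (u + e) - w u)"
  have fi: "set_integrable lborel {0..t} ?f" and gi: "set_integrable lborel {0..t} ?g"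
    by (intro kernel_path_integrable[OF w] continuous_intros)+
  have pt: "\<bar>?f u - ?g u\<bar> \<le> d * indicator {t - e..t} u" if u: "u \<in> {0..t}" for u
  proof (cases "u + e \<le> t")
    case True
    then show ?thesis using d by simp
  next
    case False
    then have "\<bar>w (min (u + e) t) - w u\<bar> \<le> d" "\<bar>w (u + e) - w u\<bar> \<le> d"
      using u e by (auto intro!: osc)
    then have "?f u \<le> d" "?g u \<le> d" "0 \<le> ?f u" "0 \<le> ?g u"
      using kernel_le kernel_nonneg by (meson order_trans)+
    then show ?thesis using False u by (auto simp: abs_le_iff)
  qed
  have "\<bar>(LBINT u:{0..t}. ?f u) - (LBINT u:{0..t}. ?g u)\<bar> = \<bar>LBINT u:{0..t}. ?f u - ?g u\<bar>"
    using fi gi by (simp add: set_integral_diff)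
  also have "\<dots> \<le> (\<integral>u. d * indicator {t - e..t} u \<partial>lborel)"
    unfolding set_lebesgue_integral_def
  proof (rule integral_abs_bound_integral)
    show "integrable lborel (\<lambda>u. indicator {0..t} u *\<^sub>R (?f u - ?g u))"
      using set_integral_diff(1)[OF fi gi] by (simp add: set_integrable_def)
    show "\<bar>indicator {0..t} u *\<^sub>R (?f u - ?g u)\<bar> \<le> d * indicator {t - e..t} u" for u
      using pt[of u] d by (cases "u \<in> {0..t}") auto
  qed (use e in auto)
  also have "\<dots> = d * e" using e by simp
  finally show ?thesis
    using e by (simp add: abs_le_iff field_simps flip: diff_divide_distrib)
qed

end

section \<open>Uniform convergence of averaged crossings\<close>

context brownian_crossing
begin

lemma crossing_integrable: "set_integrable lborel {a..b} (\<lambda>s. crossing e x s \<omega>)"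
  unfolding crossing_def
  by (intro kernel_path_integrable[OF continuous_W, where f="\<lambda>s. s + e"] continuous_intros)

lemma predicted_integrable:
  assumes "0 < e" shows "set_integrable lborel {a..b} (\<lambda>s. predicted e x s \<omega>)"
  unfolding predicted_def
  using assms profile_le profile_nonneg
  by (intro set_integrable_bounded_Icc[where B="sqrt e * (\<integral>z. \<bar>z\<bar> \<partial>std_normal)"])
     (auto simp: abs_mult)

lemma LBINT_crossing_split:
  assumes e: "0 < e"
  shows "(LBINT s:{0..t}. crossing e x s \<omega>)
    = (LBINT s:{0<..<t}. deviation e x s \<omega>) + (LBINT s:{0..t}. predicted e x s \<omega>)"
proof -
  have "(LBINT s:{0..t}. crossing e x s \<omega>) - (LBINT s:{0..t}. predicted e x s \<omega>)
      = (LBINT s:{0..t}. deviation e x s \<omega>)"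
    unfolding deviation_def
    using crossing_integrable predicted_integrable[OF e] by (simp add: set_integral_diff)
  also have "\<dots> = (LBINT s:{0<..<t}. deviation e x s \<omega>)"
    unfolding set_lebesgue_integral_def
  proof (rule integral_cong_AE)
    have [measurable]: "(\<lambda>s. deviation e x s \<omega>) \<in> borel_measurable borel"
      unfolding deviation_def crossing_def predicted_def by measurable
    show "(\<lambda>s. indicator {0..t} s *\<^sub>R deviation e x s \<omega>) \<in> borel_measurable lborel"
      "(\<lambda>s. indicator {0<..<t} s *\<^sub>R deviation e x s \<omega>) \<in> borel_measurable lborel"
      by measurable
    show "AE s in lborel. indicator {0..t} s *\<^sub>R deviation e x s \<omega> = indicator {0<..<t} s *\<^sub>R deviation e x s \<omega>"
      using AE_lborel_singleton[of 0] AE_lborel_singleton[of t]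
      by eventually_elim (auto simp: indicator_def)
  qed
  finally show ?thesis by simp
qed

lemma averaged_crossing_mono:
  assumes "0 < e" "s \<le> t"
  shows "1 / e * (LBINT u:{0..s}. crossing e x u \<omega>) \<le> 1 / e * (LBINT u:{0..t}. crossing e x u \<omega>)"
proof -
  have "(LBINT u:{0..s}. crossing e x u \<omega>) \<le> (LBINT u:{0..t}. crossing e x u \<omega>)"
    using crossing_integrable[of 0 _ e x \<omega>] assms unfolding set_lebesgue_integral_def set_integrable_def
    by (intro integral_mono) (auto simp: indicator_def crossing_def kernel_nonneg)
  with assms show ?thesis by (intro mult_left_mono) auto
qed

text \<open>
At a fixed rational time, the averaged crossing is the averaged deviation, which vanishes in the
limit, plus the averaged prediction, which converges by the occupation times formula. The averages
increase with time since kernels are nonnegative, so the convergence is uniform.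
\<close>

lemma crossing_uniform_limit:
  fixes \<epsilon> :: "nat \<Rightarrow> real"
  assumes L: "is_local_time M W L" and eps: "\<And>n. 0 < \<epsilon> n" and sum: "summable (\<lambda>n. sqrt (\<epsilon> n))"
  shows "AE \<omega> in M. uniform_limit {0..T}
    (\<lambda>n t. 1 / \<epsilon> n * (LBINT s:{0..t}. crossing (\<epsilon> n) x s \<omega>)) (\<lambda>t. mass * L t x \<omega>) sequentially"
proof -
  have lim: "\<epsilon> \<longlonglongrightarrow> 0"
    using sum eps by (rule tendsto_0_if_summable_sqrt)
  have "AE \<omega> in M. (\<lambda>n. 1 / \<epsilon> n * (LBINT s:{0<..<q}. deviation (\<epsilon> n) x s \<omega>)) \<longlonglongrightarrow> 0" if "0 \<le> q" for q
  proof (cases "q = 0")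
    case False
    with that show ?thesis by (intro averaged_deviation_tendsto_0 eps sum) auto
  qed (simp add: set_lebesgue_integral_def)
  then have "AE \<omega> in M. \<forall>q\<in>\<rat> \<inter> {0..}. (\<lambda>n. 1 / \<epsilon> n * (LBINT s:{0<..<q}. deviation (\<epsilon> n) x s \<omega>)) \<longlonglongrightarrow> 0"
    by (intro AE_ball_countable') (auto intro: countable_subset[OF _ countable_rat])
  moreover have "AE \<omega> in M. \<forall>t\<ge>0. \<forall>y. 0 \<le> L t y \<omega>"
    "AE \<omega> in M. continuous_on ({0..} \<times> UNIV) (\<lambda>(t, y). L t y \<omega>)"
    "AE \<omega> in M. \<forall>t\<ge>0. \<forall>g\<in>borel_measurable borel.
       (\<integral>\<^sup>+ s \<in> {0..t}. g (W s \<omega>) \<partial>lborel) = (\<integral>\<^sup>+ y. g y * ennreal (L t y \<omega>) \<partial>lborel)"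
    using L unfolding is_local_time_def by auto
  ultimately show ?thesis
  proof eventually_elim
    case (elim \<omega>)
    have L_space: "continuous_on UNIV (\<lambda>y. L t y \<omega>)" if "0 \<le> t" for t
    proof -
      have "continuous_on UNIV (\<lambda>y. case (t, y) of (t, y) \<Rightarrow> L t y \<omega>)"
        using that by (intro continuous_on_compose2[OF elim(3)]) (auto intro!: continuous_intros)
      then show ?thesis by simp
    qed
    have L_time: "continuous_on {0..} (\<lambda>t. L t x \<omega>)"
    proof -
      have "continuous_on {0..} (\<lambda>t. case (t, x) of (t, y) \<Rightarrow> L t y \<omega>)"
        by (intro continuous_on_compose2[OF elim(3)]) (auto intro!: continuous_intros)
      then show ?thesis by simp
    qed
    show ?case
    proof (rule uniform_limit_mono_rational)
      show "1 / \<epsilon> n * (LBINT s:{0..s}. crossing (\<epsilon> n) x s \<omega>) \<le> 1 / \<epsilon> n * (LBINT s:{0..t}. crossing (\<epsilon> n) x s \<omega>)"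
        if "s \<le> t" for n s t
        using eps that by (rule averaged_crossing_mono)
      show "continuous_on {0..} (\<lambda>t. mass * L t x \<omega>)"
        by (intro continuous_intros L_time)
      fix q :: real assume q: "q \<in> \<rat>" "0 \<le> q"
      have "(\<lambda>n. 1 / \<epsilon> n * (LBINT s:{0..q}. sqrt (\<epsilon> n) * profile ((W s \<omega> - x) / sqrt (\<epsilon> n)))) \<longlonglongrightarrow> mass * L q x \<omega>"
        using elim(2,4) q
        by (intro averaged_profile_tendsto continuous_W L_space eps lim) auto
      then have "(\<lambda>n. 1 / \<epsilon> n * (LBINT s:{0..q}. predicted (\<epsilon> n) x s \<omega>)) \<longlonglongrightarrow> mass * L q x \<omega>"
        by (simp add: predicted_def)
      from tendsto_add[OF bspec[OF elim(1)] this] q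
      show "(\<lambda>n. 1 / \<epsilon> n * (LBINT s:{0..q}. crossing (\<epsilon> n) x s \<omega>)) \<longlonglongrightarrow> mass * L q x \<omega>"
        by (simp add: LBINT_crossing_split[OF eps] add_divide_distrib)
    qed
  qed
qed

lemma truncated_crossing_uniform_limit:
  fixes \<epsilon> :: "nat \<Rightarrow> real"
  assumes L: "is_local_time M W L" and eps: "\<And>n. 0 < \<epsilon> n" and sum: "summable (\<lambda>n. sqrt (\<epsilon> n))"
  shows "AE \<omega> in M. uniform_limit {0..T}
    (\<lambda>n t. 1 / \<epsilon> n * (LBINT u:{0..t}. h (W u \<omega> - x) (W (min (u + \<epsilon> n) t) \<omega> - W u \<omega>)))
    (\<lambda>t. mass * L t x \<omega>) sequentially"
  using crossing_uniform_limit[OF assms, where T=T and x=x]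
proof eventually_elim
  case (elim \<omega>)
  have lim: "\<epsilon> \<longlonglongrightarrow> 0"
    using sum eps by (rule tendsto_0_if_summable_sqrt)
  show ?case
  proof (rule uniform_limitI)
    fix e :: real assume e: "0 < e"
    \<comment> \<open>the margins leave room for a window of length at most 1 to either side of \<open>[0, T]\<close>\<close>
    have "uniformly_continuous_on {-1..T + 1} (\<lambda>t. W t \<omega>)"
      by (rule compact_uniformly_continuous) (auto intro: continuous_on_subset[OF continuous_W])
    from this[unfolded uniformly_continuous_on_def, rule_format, OF half_gt_zero[OF e]]
    obtain d where d: "0 < d" "\<And>s t. s \<in> {-1..T + 1} \<Longrightarrow> t \<in> {-1..T + 1} \<Longrightarrow> dist t s < d \<Longrightarrow> dist (W t \<omega>) (W s \<omega>) < e/2"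
      by blast
    have "\<forall>\<^sub>F n in sequentially. \<epsilon> n < min d 1"
      using lim d(1) by (intro order_tendstoD) auto
    with uniform_limitD[OF elim half_gt_zero[OF e]]
    show "\<forall>\<^sub>F n in sequentially. \<forall>t\<in>{0..T}.
        dist (1 / \<epsilon> n * (LBINT u:{0..t}. h (W u \<omega> - x) (W (min (u + \<epsilon> n) t) \<omega> - W u \<omega>))) (mass * L t x \<omega>) < e"
    proof eventually_elim
      case (elim n)
      show ?case
      proof
      fix t assume t: "t \<in> {0..T}"
      have "\<bar>1 / \<epsilon> n * (LBINT u:{0..t}. h (W u \<omega> - x) (W (min (u + \<epsilon> n) t) \<omega> - W u \<omega>))
          - 1 / \<epsilon> n * (LBINT u:{0..t}. h (W u \<omega> - x) (W (u + \<epsilon> n) \<omega> - W u \<omega>))\<bar> \<le> e / 2"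
      proof (rule truncated_crossing_close[OF continuous_W eps])
        show "\<bar>W v \<omega> - W u \<omega>\<bar> \<le> e / 2" if "u \<in> {0..t}" "\<bar>u - v\<bar> \<le> \<epsilon> n" for u v
          using d(2)[of u v] that elim(2) t by (auto simp: dist_real_def abs_le_iff abs_less_iff)
      qed (use e in simp)
      with bspec[OF elim(1) t] show "dist (1 / \<epsilon> n * (LBINT u:{0..t}. h (W u \<omega> - x) (W (min (u + \<epsilon> n) t) \<omega> - W u \<omega>)))
          (mass * L t x \<omega>) < e"
        unfolding dist_real_def crossing_def by linarith
      qed
    qed
  qed
qed

end

section \<open>A version with continuous paths\<close>

context standard_brownian_motion
begin

lemma standardized_increment:
  assumes "0 \<le> s" "0 < e"
  shows "distr M borel (\<lambda>\<omega>. (X (s + e) \<omega> - X s \<omega>) / sqrt e) = std_normal"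
proof -
  have "distributed M lborel (\<lambda>\<omega>. X (s + e) \<omega> - X s \<omega>) (normal_density 0 (sqrt e))"
    using gaussian_increments[of s "s + e"] assms by simp
  then have "distributed M lborel (\<lambda>\<omega>. (X (s + e) \<omega> - X s \<omega> - 0) / sqrt e) std_normal_density"
    using assms by (subst (asm) normal_standard_normal_convert) auto
  from distributed_distr_eq_density[OF this] show ?thesis
    by (simp add: std_normal_def cong: distr_cong)
qed

text \<open>The positions at three ordered times are partial sums of the first three of four consecutive
increments, so their joint law with the fourth one is the image of a product measure.\<close>

lemma past_increment_law:
  assumes "0 \<le> r" "r \<le> r'" "r' \<le> s" "0 < e"
  shows "distr M ((borel \<Otimes>\<^sub>M borel \<Otimes>\<^sub>M borel) \<Otimes>\<^sub>M borel)
      (\<lambda>\<omega>. ((X r \<omega> - X 0 \<omega>, X r' \<omega> - X 0 \<omega>, X s \<omega> - X 0 \<omega>), (X (s + e) \<omega> - X s \<omega>) / sqrt e))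
    = distr M (borel \<Otimes>\<^sub>M borel \<Otimes>\<^sub>M borel) (\<lambda>\<omega>. (X r \<omega> - X 0 \<omega>, X r' \<omega> - X 0 \<omega>, X s \<omega> - X 0 \<omega>))
      \<Otimes>\<^sub>M std_normal"
proof -
  \<comment> \<open>the entry 0 makes the first increment \<open>X r - X 0\<close>\<close>
  define \<tau> where "\<tau> = (\<lambda>i::nat. [0, r, r', s, s + e] ! i)"
  define D where "D = (\<lambda>i \<omega>. X (\<tau> (Suc i)) \<omega> - X (\<tau> i) \<omega>)"
  have "indep_vars (\<lambda>_. borel) D {..<4}"
    unfolding D_def
  proof (rule independent_increments)
    show "\<tau> i \<le> \<tau> (Suc i)" if "i < 4" for i
      using that assms by (auto simp: \<tau>_def less_Suc_eq numeral_eq_Suc)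
  qed (simp add: \<tau>_def)
  then have ind: "indep_var (PiM {..<3} (\<lambda>_. borel)) (\<lambda>\<omega>. restrict (\<lambda>i. D i \<omega>) {..<3})
      (PiM {3} (\<lambda>_. borel)) (\<lambda>\<omega>. restrict (\<lambda>i. D i \<omega>) {3})"
    by (rule indep_var_restrict) auto
  let ?P = "PiM {..<3} (\<lambda>_. borel) :: (nat \<Rightarrow> real) measure" and ?Q = "PiM {3} (\<lambda>_. borel) :: (nat \<Rightarrow> real) measure"
  let ?U = "\<lambda>\<omega>. restrict (\<lambda>i. D i \<omega>) {..<3}" and ?V = "\<lambda>\<omega>. restrict (\<lambda>i. D i \<omega>) {3}"
  let ?N = "borel \<Otimes>\<^sub>M borel \<Otimes>\<^sub>M borel :: (real \<times> real \<times> real) measure"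
  let ?f = "\<lambda>u :: nat \<Rightarrow> real. (u 0, u 0 + u 1, u 0 + u 1 + u 2)" and ?g = "\<lambda>v :: nat \<Rightarrow> real. v 3 / sqrt e"
  have [measurable]: "?U \<in> measurable M ?P" "?V \<in> measurable M ?Q"
    using ind by (auto dest: indep_var_rv1 indep_var_rv2)
  have law: "distr M ?P ?U \<Otimes>\<^sub>M distr M ?Q ?V = distr M (?P \<Otimes>\<^sub>M ?Q) (\<lambda>\<omega>. (?U \<omega>, ?V \<omega>))"
    using ind unfolding indep_var_distribution_eq by simp
  have [measurable]: "(\<lambda>u. u i) \<in> borel_measurable ?P" if "i < 3" for i
    using that by (intro measurable_component_singleton) simp
  have f: "?f \<in> measurable ?P ?N" by measurable
  have g: "?g \<in> borel_measurable ?Q" by measurable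
  have U: "?f (?U \<omega>) = (X r \<omega> - X 0 \<omega>, X r' \<omega> - X 0 \<omega>, X s \<omega> - X 0 \<omega>)" for \<omega>
    by (simp add: D_def \<tau>_def numeral_eq_Suc)
  have V: "?g (?V \<omega>) = (X (s + e) \<omega> - X s \<omega>) / sqrt e" for \<omega>
    by (simp add: D_def \<tau>_def numeral_eq_Suc)
  interpret V: prob_space "distr M ?Q ?V" by (rule prob_space_distr) measurable
  have "distr M (?N \<Otimes>\<^sub>M borel) (\<lambda>\<omega>. (?f (?U \<omega>), ?g (?V \<omega>)))
      = distr (distr M (?P \<Otimes>\<^sub>M ?Q) (\<lambda>\<omega>. (?U \<omega>, ?V \<omega>))) (?N \<Otimes>\<^sub>M borel) (\<lambda>(u, v). (?f u, ?g v))"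
    using f g by (subst distr_distr) (auto simp: comp_def)
  also have "\<dots> = distr (distr M ?P ?U) ?N ?f \<Otimes>\<^sub>M distr (distr M ?Q ?V) borel ?g"
    unfolding law[symmetric] using f g
    by (intro pair_measure_distr[symmetric])
       (auto intro!: prob_space_imp_sigma_finite V.prob_space_distr)
  also have "distr (distr M ?P ?U) ?N ?f = distr M ?N (\<lambda>\<omega>. ?f (?U \<omega>))"
    using f by (subst distr_distr) (auto simp: comp_def)
  also have "distr (distr M ?Q ?V) borel ?g = distr M borel (\<lambda>\<omega>. ?g (?V \<omega>))"
    using g by (subst distr_distr) (auto simp: comp_def)
  finally show ?thesis
    unfolding U V using assms by (simp add: standardized_increment)
qed

text \<open>Outside a measurable set of full measure the paths are replaced by 0, and before time 0 each path is
continued by its initial value. On the set, the new process agrees with \<^term>\<open>X\<close> at all nonnegative times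
simultaneously, not merely at each time, so path functionals agree as well.\<close>

lemma obtain_continuous_version:
  obtains \<Omega> where "\<Omega> \<in> sets M" "AE \<omega> in M. \<omega> \<in> \<Omega>"
    "continuous_brownian_motion M (\<lambda>t \<omega>. if \<omega> \<in> \<Omega> then X (max 0 t) \<omega> else 0)"
proof -
  have "AE \<omega> in M. continuous_on {0..} (\<lambda>t. X t \<omega>) \<and> X 0 \<omega> = 0"
    using continuous_paths start_zero by eventually_elim simp
  then obtain N where N: "N \<in> null_sets M"
      "{\<omega> \<in> space M. \<not> (continuous_on {0..} (\<lambda>t. X t \<omega>) \<and> X 0 \<omega> = 0)} \<subseteq> N"
    by (auto simp: eventually_ae_filter)
  define \<Omega> where "\<Omega> = space M - N"
  define W where "W = (\<lambda>t \<omega>. if \<omega> \<in> \<Omega> then X (max 0 t) \<omega> else 0)"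
  have \<Omega> [measurable]: "\<Omega> \<in> sets M" using N by (auto simp: \<Omega>_def)
  have AE_\<Omega>: "AE \<omega> in M. \<omega> \<in> \<Omega>"
    using AE_not_in[OF N(1)] AE_space by eventually_elim (auto simp: \<Omega>_def)
  have good: "continuous_on {0..} (\<lambda>t. X t \<omega>)" "X 0 \<omega> = 0" if "\<omega> \<in> \<Omega>" for \<omega>
    using that N(2) by (auto simp: \<Omega>_def)
  have X_meas: "X (max 0 t) \<in> borel_measurable M" for t
    by (rule random_variable_X) simp
  have X_meas' [measurable]: "X t \<in> borel_measurable M" if "0 \<le> t" for t
    using that by (rule random_variable_X)
  have W_meas [measurable]: "W t \<in> borel_measurable M" for t
    unfolding W_def using X_meas by measurable
  have W_X: "W t \<omega> = X t \<omega> - X 0 \<omega>" if "\<omega> \<in> \<Omega>" "0 \<le> t" for t \<omega>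
    using that good by (simp add: W_def)
  have "continuous_brownian_motion M W"
  proof
    show "W t \<in> borel_measurable M" for t by measurable
    show "continuous_on UNIV (\<lambda>t. W t \<omega>)" for \<omega>
    proof (cases "\<omega> \<in> \<Omega>")
      case True
      then show ?thesis
        unfolding W_def by (auto intro!: continuous_on_compose2[OF good(1)] continuous_intros)
    qed (simp add: W_def)
    show "distributed M lborel (W s) (normal_density 0 (sqrt s))" if "0 < s" for s
    proof -
      have "distr M lborel (W s) = distr M lborel (\<lambda>\<omega>. X s \<omega> - X 0 \<omega>)"
        using AE_\<Omega> that by (intro distr_cong_AE) (auto simp: W_X elim!: eventually_mono)
      then show ?thesis
        using gaussian_increments[of 0 s] that by (simp add: distributed_def)
    qed
    show "distr M borel (\<lambda>\<omega>. (W (s + e) \<omega> - W s \<omega>) / sqrt e) = std_normal" if "0 \<le> s" "0 < e" for s e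
    proof -
      have "distr M borel (\<lambda>\<omega>. (W (s + e) \<omega> - W s \<omega>) / sqrt e) = distr M borel (\<lambda>\<omega>. (X (s + e) \<omega> - X s \<omega>) / sqrt e)"
        using AE_\<Omega> that by (intro distr_cong_AE) (auto simp: W_X elim!: eventually_mono)
      with that show ?thesis by (simp add: standardized_increment)
    qed
    show "distr M ((borel \<Otimes>\<^sub>M borel \<Otimes>\<^sub>M borel) \<Otimes>\<^sub>M borel)
          (\<lambda>\<omega>. ((W r \<omega>, W r' \<omega>, W s \<omega>), (W (s + e) \<omega> - W s \<omega>) / sqrt e))
        = distr M (borel \<Otimes>\<^sub>M borel \<Otimes>\<^sub>M borel) (\<lambda>\<omega>. (W r \<omega>, W r' \<omega>, W s \<omega>)) \<Otimes>\<^sub>M std_normal"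
      if "0 \<le> r" "r \<le> r'" "r' \<le> s" "0 < e" for r r' s e
    proof -
      have "distr M ((borel \<Otimes>\<^sub>M borel \<Otimes>\<^sub>M borel) \<Otimes>\<^sub>M borel)
          (\<lambda>\<omega>. ((W r \<omega>, W r' \<omega>, W s \<omega>), (W (s + e) \<omega> - W s \<omega>) / sqrt e))
        = distr M ((borel \<Otimes>\<^sub>M borel \<Otimes>\<^sub>M borel) \<Otimes>\<^sub>M borel)
          (\<lambda>\<omega>. ((X r \<omega> - X 0 \<omega>, X r' \<omega> - X 0 \<omega>, X s \<omega> - X 0 \<omega>), (X (s + e) \<omega> - X s \<omega>) / sqrt e))"
        using AE_\<Omega> that by (intro distr_cong_AE) (auto simp: W_X elim!: eventually_mono)
      moreover have "distr M (borel \<Otimes>\<^sub>M borel \<Otimes>\<^sub>M borel) (\<lambda>\<omega>. (W r \<omega>, W r' \<omega>, W s \<omega>))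
        = distr M (borel \<Otimes>\<^sub>M borel \<Otimes>\<^sub>M borel) (\<lambda>\<omega>. (X r \<omega> - X 0 \<omega>, X r' \<omega> - X 0 \<omega>, X s \<omega> - X 0 \<omega>))"
        using AE_\<Omega> that by (intro distr_cong_AE) (auto simp: W_X elim!: eventually_mono)
      ultimately show ?thesis using past_increment_law[OF that] by simp
    qed
  qed
  then show ?thesis using \<Omega> AE_\<Omega> unfolding W_def by (rule that[rotated 2])
qed

end

section \<open>Convergence to the local time\<close>

lemma is_local_time_cong:
  assumes "AE \<omega> in M. \<forall>t\<ge>0. X t \<omega> = Y t \<omega>" and L: "is_local_time M X L"
  shows "is_local_time M Y L"
proof -
  have "AE \<omega> in M. \<forall>t\<ge>0. \<forall>g \<in> borel_measurable borel.
       (\<integral>\<^sup>+ s \<in> {0..t}. g (X s \<omega>) \<partial>lborel) = (\<integral>\<^sup>+ x. g x * ennreal (L t x \<omega>) \<partial>lborel)"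
    using L unfolding is_local_time_def by blast
  with assms(1) have "AE \<omega> in M. \<forall>t\<ge>0. \<forall>g \<in> borel_measurable borel.
       (\<integral>\<^sup>+ s \<in> {0..t}. g (Y s \<omega>) \<partial>lborel) = (\<integral>\<^sup>+ x. g x * ennreal (L t x \<omega>) \<partial>lborel)"
  proof eventually_elim
    case (elim \<omega>)
    have "(\<integral>\<^sup>+ s \<in> {0..t}. g (Y s \<omega>) \<partial>lborel) = (\<integral>\<^sup>+ s \<in> {0..t}. g (X s \<omega>) \<partial>lborel)"
      for t and g :: "real \<Rightarrow> ennreal"
      using elim(1) by (intro nn_integral_cong) (simp add: indicator_def)
    with elim(2) show ?case by simp
  qed
  with L show ?thesis unfolding is_local_time_def by blast
qed

text \<open>From relative position \<open>y\<close>, an increment \<open>z\<close> ends strictly above the level if and only if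
\<open>0 < y + z\<close>; and only nonnegative times occur, where the two processes agree.\<close>

lemma functionals_eq_kernel_integrals:
  assumes eq: "\<And>t. 0 \<le> t \<Longrightarrow> X t \<omega> = W t \<omega>" and e: "0 < e"
  shows "J X e t x \<omega> = 1 / e * (LBINT s:{0..t}. sign_change (W s \<omega> - x) (W (s + e) \<omega> - W s \<omega>))"
    and "I41 X e t x \<omega> = 1 / e * (LBINT u:{0..t}. up_cross (W u \<omega> - x) (W (min (u + e) t) \<omega> - W u \<omega>))"
    and "I42 X e t x \<omega> = 1 / e * (LBINT u:{0..t}. down_cross (W u \<omega> - x) (W (min (u + e) t) \<omega> - W u \<omega>))"
  unfolding J_def I41_def I42_def set_lebesgue_integral_def sign_change_def up_cross_def down_cross_def
  using e by (auto intro!: arg_cong[where f="\<lambda>i. i / e"] Bochner_Integration.integral_cong simp: eq indicator_def)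

theorem proposition1p7:
  fixes M :: "'a measure"
    and X :: "real \<Rightarrow> 'a \<Rightarrow> real"
    and L :: "real \<Rightarrow> real \<Rightarrow> 'a \<Rightarrow> real"
    and T x :: real
    and \<epsilon> :: "nat \<Rightarrow> real"
  assumes "standard_brownian_motion M X"
    and "is_local_time M X L"
    and "T > 0"
    and "\<And>n. \<epsilon> n > 0"
    and "decseq \<epsilon>"
    and "summable (\<lambda>n. sqrt (\<epsilon> n))"
  shows "AE \<omega> in M.
    ((\<lambda>n. sup_dist T (\<lambda>t. J X (\<epsilon> n) t x \<omega>) (\<lambda>t. L t x \<omega>)) \<longlonglongrightarrow> 0) \<and>
    ((\<lambda>n. sup_dist T (\<lambda>t. I41 X (\<epsilon> n) t x \<omega>) (\<lambda>t. 1 / 4 * L t x \<omega>)) \<longlonglongrightarrow> 0) \<and>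
    ((\<lambda>n. sup_dist T (\<lambda>t. I42 X (\<epsilon> n) t x \<omega>) (\<lambda>t. 1 / 4 * L t x \<omega>)) \<longlonglongrightarrow> 0)"
proof -
  interpret standard_brownian_motion M X by fact
  obtain \<Omega> where \<Omega>: "\<Omega> \<in> sets M" "AE \<omega> in M. \<omega> \<in> \<Omega>"
    "continuous_brownian_motion M (\<lambda>t \<omega>. if \<omega> \<in> \<Omega> then X (max 0 t) \<omega> else 0)"
    by (rule obtain_continuous_version)
  define W where "W = (\<lambda>t \<omega>. if \<omega> \<in> \<Omega> then X (max 0 t) \<omega> else 0)"
  have X_eq: "AE \<omega> in M. \<forall>t\<ge>0. X t \<omega> = W t \<omega>"
    using \<Omega>(2) by eventually_elim (simp add: W_def)
  interpret W: continuous_brownian_motion M W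
    using \<Omega>(3) by (simp add: W_def)
  interpret sc: brownian_crossing M W sign_change ..
  interpret uc: brownian_crossing M W up_cross ..
  interpret dc: brownian_crossing M W down_cross ..
  have L: "is_local_time M W L"
    by (rule is_local_time_cong[OF X_eq assms(2)])
  note sc.crossing_uniform_limit[OF L assms(4,6), where T=T and x=x, unfolded sc.crossing_def mass_sign_change]
    uc.truncated_crossing_uniform_limit[OF L assms(4,6), where T=T and x=x, unfolded mass_up_cross]
    dc.truncated_crossing_uniform_limit[OF L assms(4,6), where T=T and x=x, unfolded mass_down_cross]
  with X_eq show ?thesis
  proof eventually_elim
    case (elim \<omega>)
    note eq = functionals_eq_kernel_integrals[of X \<omega> W, OF elim(1)[rule_format] assms(4)]
    show ?case
      using elim(2-4)[THEN sup_dist_tendsto_0I] by (simp add: eq)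
  qed
qed

end
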